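(* The following three identities hold: $$\sum_{k=1}^{\infty} \frac{(-256)^k \left( (40k^2 - 24k + 3)(2H_{4k-1} - H_{2k-1}) - 12k + 4 \right)}{k^3(2k-1)\binom{2k}{k}\binom{4k}{2k}^2} = -4 \pi^3,$$ $$\sum_{k=1}^{\infty} \frac{(-256)^k \left( (40k^2 - 24k + 3)(5H_{2k-1} - 3H_{k-1}) - \frac{88k^2 - 48k + 7}{2k-1} \right)}{k^3(2k-1)\binom{2k}{k}\binom{4k}{2k}^2} = -4 \pi^3,$$ and $$\sum_{k=1}^{\infty} \frac{(-256)^k \left( (40k^2 - 24k + 3)(4H_{4k-1}^{(2)} - H_{2k-1}^{(2)} - H_{k-1}^{(2)}) - 4 \right)}{k^3(2k-1)\binom{2k}{k}\binom{4k}{2k}^2} = -256 \beta(4).$$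
   Context: For integers $m\ge1$ and $n\ge0$, $H_n^{(m)}=\sum_{0<j\le n}\frac1{j^m}$ denotes the harmonic number of order $m$, and $H_n=H_n^{(1)}$ (so $H_0=H_0^{(m)}=0$). Also $\beta(4) = \sum_{k=0}^\infty \frac{(-1)^k}{(2k+1)^4}$. *)

theory Defs
  imports "HOL-Analysis.Analysis"
begin

definition harmonic :: "nat \<Rightarrow> nat \<Rightarrow> real" where
  "harmonic m n = (\<Sum>j\<in>{0<..n}. 1 / real j ^ m)"

abbreviation harmonic1 :: "nat \<Rightarrow> real" where
  "harmonic1 n \<equiv> harmonic 1 n"

definition dirichlet_beta :: "nat \<Rightarrow> real" where
  "dirichlet_beta s = (\<Sum>k. (-1) ^ k / (2 * real k + 1) ^ s)"

end

theory Submission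
  imports Defs "HOL-Complex_Analysis.Complex_Analysis" "HOL-Real_Asymp.Real_Asymp"
begin

text \<open>
  The three series are derivatives, at a common central point, of one accelerated hypergeometric
  series with parameters. Consider the well-poised alternating sum (with summand \<open>wp_term\<close>)
  \<open>W(a;b,c,d) = \<Sum>n. (-1)^n (a+2n) (b)_n (c)_n (d)_n / ((1+a-b)_n (1+a-c)_n (1+a-d)_n).\<close>
  Two telescoping relations express \<open>W(a;b,c,d)\<close> through \<open>W(a+1;b,c,d)\<close> and through
  \<open>W(a+1;b+1,c,d)\<close>. Alternating them steps from \<open>(a;b,c,d)\<close> to \<open>(a+2;b+1,c,d)\<close>; every double
  step contributes one term (\<open>accel_head\<close>) and multiplies the remainder by a factor close to \<open>-1/4\<close>
  (\<open>accel_factor\<close>). Iterating gives the fast series of \<open>wp_accelerated_sums\<close>. At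
  \<open>a = 1\<close>, \<open>b = c = d = 1/2\<close> its terms are, up to scaling, the fraction
  \<open>(-256)^k (40k^2-24k+3) / (k^3 (2k-1) C(2k,k) C(4k,2k)^2)\<close>: the Pochhammer symbols at integers
  and at half-integers combine to the central binomial coefficients.

  When \<open>a\<close> is the sum of two of the three parameters and twice the third, the ratios in \<open>W\<close>
  collapse, and \<open>W\<close> is a multiple of \<open>\<Sum>n. 2 (-1)^n / ((u+n)(v+n))\<close>. Both sides are then
  holomorphic in the deformation and dominated by fixed summable sequences, so the identity may be
  differentiated term by term (\<open>sums_derivative_transfer\<close>). Logarithmic derivatives of Pochhammer
  symbols at \<open>1\<close> and \<open>1/2\<close> are harmonic numbers and their odd-index analogues.

  Moving \<open>b = u\<close>, \<open>c = v\<close> and \<open>d = (u+v)/2\<close> with velocities \<open>p\<close>, \<open>q\<close>, \<open>(p+q)/2\<close> gives the simple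
  sum the derivative \<open>-(p+q)/2\<close> times \<open>32 \<beta>(3) = \<pi>^3\<close> (\<open>first_order_variation\<close>). The velocities \<open>(1,1)\<close> keep the
  integer-based parameters at \<open>1\<close> and yield the combination \<open>2H_{4k-1} - H_{2k-1}\<close>; the velocities \<open>(1,-3)\<close> yield
  \<open>5H_{2k-1} - 3H_{k-1}\<close>. For the third series one keeps \<open>a = 1\<close>, \<open>b = 1/2\<close> and moves \<open>c\<close>, \<open>d\<close> to
  \<open>1/2 \<plusminus> \<surd>w\<close>. Everything depends on \<open>w\<close> alone, and the derivative in \<open>w\<close> produces second-order
  harmonic numbers and \<open>\<beta>(4)\<close> (\<open>second_order_variation\<close>).
\<close>

section \<open>Contiguous relations for a well-poised alternating sum\<close>

definition wp_ratio :: "complex \<Rightarrow> complex \<Rightarrow> complex \<Rightarrow> complex \<Rightarrow> nat \<Rightarrow> complex" where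
  "wp_ratio a b c d n =
     (pochhammer b n * pochhammer c n * pochhammer d n) /
     (pochhammer (1 + a - b) n * pochhammer (1 + a - c) n * pochhammer (1 + a - d) n)"

definition wp_term :: "complex \<Rightarrow> complex \<Rightarrow> complex \<Rightarrow> complex \<Rightarrow> nat \<Rightarrow> complex" where
  "wp_term a b c d n = (-1) ^ n * (a + 2 * of_nat n) * wp_ratio a b c d n"

lemma pochhammer_shift1:
  fixes x :: complex
  assumes "x \<noteq> 0"
  shows "pochhammer (x + 1) n = pochhammer x n * (x + of_nat n) / x"
proof -
  have "pochhammer x n * (x + of_nat n) = x * pochhammer (x + 1) n"
    by (metis pochhammer_Suc pochhammer_rec)
  thus ?thesis using assms by (simp add: field_simps)
qed

lemma wp_ratio_0 [simp]: "wp_ratio a b c d 0 = 1"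
  by (simp add: wp_ratio_def)

lemma wp_ratio_Suc:
  "wp_ratio a b c d (Suc n) = wp_ratio a b c d n *
     ((b + of_nat n) * (c + of_nat n) * (d + of_nat n) /
      ((1 + a - b + of_nat n) * (1 + a - c + of_nat n) * (1 + a - d + of_nat n)))"
  by (simp add: wp_ratio_def pochhammer_Suc mult_ac)

lemma wp_ratio_shift_a:
  assumes "1 + a - b \<noteq> 0" "1 + a - c \<noteq> 0" "1 + a - d \<noteq> 0"
  shows "wp_ratio (a + 1) b c d n = wp_ratio a b c d n *
     ((1 + a - b) * (1 + a - c) * (1 + a - d) /
      ((1 + a - b + of_nat n) * (1 + a - c + of_nat n) * (1 + a - d + of_nat n)))"
proof -
  have *: "1 + (a + 1) - x = (1 + a - x) + 1" for x by simp
  show ?thesis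
    unfolding wp_ratio_def * pochhammer_shift1[OF assms(1)] pochhammer_shift1[OF assms(2)]
      pochhammer_shift1[OF assms(3)]
    by (simp add: mult_ac)
qed

lemma wp_ratio_shift_ab:
  assumes "b \<noteq> 0" "1 + a - c \<noteq> 0" "1 + a - d \<noteq> 0"
  shows "wp_ratio (a + 1) (b + 1) c d n = wp_ratio a b c d n *
     ((b + of_nat n) * (1 + a - c) * (1 + a - d) /
      (b * (1 + a - c + of_nat n) * (1 + a - d + of_nat n)))"
proof -
  have *: "1 + (a + 1) - x = (1 + a - x) + 1" for x by simp
  have **: "1 + (a + 1) - (b + 1) = 1 + a - b" by simp
  show ?thesis
    unfolding wp_ratio_def ** unfolding * pochhammer_shift1[OF assms(1)]
      pochhammer_shift1[OF assms(2)] pochhammer_shift1[OF assms(3)]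
    by (simp add: mult_ac)
qed

text \<open>
  The difference between the summand and the multiple of the shifted summand is \<open>g (n+1) - g n\<close>
  with \<open>g n = - (-1)^n (s+n) wp_ratio a b c d n\<close>. Write \<open>X\<close> and \<open>Y\<close> for the
  products of the new denominator and numerator factors. The polynomial \<open>(a+n-s) X - (s+n+1) Y\<close> in \<open>n\<close> has no
  terms of degree four and is odd under \<open>n \<mapsto> - 1 - a - n\<close>, which exchanges \<open>X\<close> and \<open>- Y\<close>. The value
  of \<open>s\<close> removes the terms of degree three, so that a multiple of \<open>a+1+2n\<close> remains.
\<close>
lemma wp_partial_sum_shift_a:
  assumes nz: "\<And>n::nat. 1 + a - b + of_nat n \<noteq> 0" "\<And>n::nat. 1 + a - c + of_nat n \<noteq> 0"
    "\<And>n::nat. 1 + a - d + of_nat n \<noteq> 0"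
  defines "s \<equiv> 1 + 2 * a - b - c - d"
  shows "(\<Sum>n<N. wp_term a b c d n) =
     s - (1 + a - b - c) * (1 + a - b - d) * (1 + a - c - d) /
         ((1 + a - b) * (1 + a - c) * (1 + a - d)) * (\<Sum>n<N. wp_term (a + 1) b c d n)
       - (-1) ^ N * (s + of_nat N) * wp_ratio a b c d N"
proof (induction N)
  case 0
  show ?case by simp
next
  case (Suc N)
  define w where "w = wp_ratio a b c d N"
  define m :: complex where "m = of_nat N"
  define e :: complex where "e = (-1) ^ N"
  define B C D where "B = 1 + a - b + m" and "C = 1 + a - c + m" and "D = 1 + a - d + m"
  define P where "P = (1 + a - b) * (1 + a - c) * (1 + a - d)"
  have nz0: "1 + a - b \<noteq> 0" "1 + a - c \<noteq> 0" "1 + a - d \<noteq> 0"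
    using nz[of 0] by simp_all
  have nzm: "B \<noteq> 0" "C \<noteq> 0" "D \<noteq> 0" "P \<noteq> 0"
    using nz[of N] nz0 by (simp_all add: m_def B_def C_def D_def P_def)
  have key: "(a + 2 * m) * (B * C * D) =
      - ((1 + a - b - c) * (1 + a - b - d) * (1 + a - c - d)) * (a + 1 + 2 * m)
      + (s + m + 1) * ((b + m) * (c + m) * (d + m)) + (s + m) * (B * C * D)"
    unfolding B_def C_def D_def s_def by algebra
  define k where "k = (1 + a - b - c) * (1 + a - b - d) * (1 + a - c - d) / P"
  have rel: "wp_term a b c d N =
      - k * wp_term (a + 1) b c d N
      + e * (s + m + 1) * wp_ratio a b c d (Suc N) + e * (s + m) * w"
  proof -
    have t1: "wp_term (a + 1) b c d N = e * (a + 1 + 2 * m) * (w * (P / (B * C * D)))"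
      unfolding wp_term_def wp_ratio_shift_a[OF nz0] e_def w_def m_def P_def B_def C_def D_def by simp
    have t2: "wp_ratio a b c d (Suc N) = w * ((b + m) * (c + m) * (d + m) / (B * C * D))"
      unfolding wp_ratio_Suc w_def m_def B_def C_def D_def by simp
    have t3: "wp_term a b c d N = e * (a + 2 * m) * w"
      by (simp add: wp_term_def e_def m_def w_def)
    define X Q Y where "X = B * C * D" and "Q = (1 + a - b - c) * (1 + a - b - d) * (1 + a - c - d)"
      and "Y = (b + m) * (c + m) * (d + m)"
    have X: "X \<noteq> 0" using nzm by (simp add: X_def)
    have a2: "a + 2 * m = (- Q * (a + 1 + 2 * m) + (s + m + 1) * Y + (s + m) * X) / X"
      using key X unfolding X_def[symmetric] Q_def[symmetric] Y_def[symmetric]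
      by (simp add: field_simps)
    have "e * (a + 2 * m) * w = e * w * ((- Q * (a + 1 + 2 * m) + (s + m + 1) * Y + (s + m) * X) / X)"
      by (subst a2) simp
    also have "\<dots> = - Q / P * (e * (a + 1 + 2 * m) * (w * (P / X))) + e * (s + m + 1) * (w * (Y / X))
        + e * (s + m) * w"
      using X nzm(4) by (simp add: field_simps)
    finally show ?thesis
      unfolding t1 t2 t3 k_def X_def Q_def Y_def by simp
  qed
  moreover have "(\<Sum>n<N. wp_term a b c d n) =
      s - k * (\<Sum>n<N. wp_term (a + 1) b c d n) - e * (s + m) * w"
    using Suc.IH by (simp add: k_def P_def e_def m_def w_def)
  ultimately have "(\<Sum>n<N. wp_term a b c d n) + wp_term a b c d N =
      s - k * ((\<Sum>n<N. wp_term (a + 1) b c d n) + wp_term (a + 1) b c d N)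
        - (- e) * (s + (m + 1)) * wp_ratio a b c d (Suc N)"
    by algebra
  thus ?case
    by (simp add: k_def P_def e_def m_def add.commute)
qed

text \<open>
  Here the certificate is \<open>g n = - (-1)^n (a-b+n) wp_ratio a b c d n\<close>. After removing the common factor
  \<open>b+n\<close> the relation reduces to
  \<open>(1+a-c+n)(1+a-d+n) - (c+n)(d+n) = (1+a-c-d)(1+a+2n)\<close>.
\<close>
lemma wp_partial_sum_shift_ab:
  assumes nz: "b \<noteq> 0" "\<And>n::nat. 1 + a - b + of_nat n \<noteq> 0" "\<And>n::nat. 1 + a - c + of_nat n \<noteq> 0"
    "\<And>n::nat. 1 + a - d + of_nat n \<noteq> 0"
  shows "(\<Sum>n<N. wp_term a b c d n) =
     (a - b) + b * (1 + a - c - d) /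
         ((1 + a - c) * (1 + a - d)) * (\<Sum>n<N. wp_term (a + 1) (b + 1) c d n)
       - (-1) ^ N * (a - b + of_nat N) * wp_ratio a b c d N"
proof (induction N)
  case 0
  show ?case by simp
next
  case (Suc N)
  define w where "w = wp_ratio a b c d N"
  define m :: complex where "m = of_nat N"
  define e :: complex where "e = (-1) ^ N"
  define B C D where "B = 1 + a - b + m" and "C = 1 + a - c + m" and "D = 1 + a - d + m"
  define P where "P = (1 + a - c) * (1 + a - d)"
  have nz0: "1 + a - c \<noteq> 0" "1 + a - d \<noteq> 0"
    using nz(3)[of 0] nz(4)[of 0] by simp_all
  have nzm: "B \<noteq> 0" "C \<noteq> 0" "D \<noteq> 0" "P \<noteq> 0"
    using nz(2-4)[of N] nz0 by (simp_all add: m_def B_def C_def D_def P_def)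
  have key: "(a + 2 * m) * (C * D) =
      (b + m) * (1 + a - c - d) * (a + 1 + 2 * m)
      + ((b + m) * (c + m) * (d + m)) + (a - b + m) * (C * D)"
    unfolding B_def C_def D_def by algebra
  define k where "k = b * (1 + a - c - d) / P"
  have rel: "wp_term a b c d N =
      k * wp_term (a + 1) (b + 1) c d N
      + e * (a - b + m + 1) * wp_ratio a b c d (Suc N) + e * (a - b + m) * w"
  proof -
    define X Q Y where "X = C * D" and "Q = 1 + a - c - d"
      and "Y = (b + m) * (c + m) * (d + m)"
    have t1: "wp_term (a + 1) (b + 1) c d N = e * (a + 1 + 2 * m) * (w * ((b + m) * P / (b * X)))"
      unfolding wp_term_def wp_ratio_shift_ab[OF nz(1) nz0] e_def w_def m_def P_def C_def D_def X_def
      by (simp add: mult_ac)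
    have "a - b + m + 1 = B" by (simp add: B_def)
    hence t2: "(a - b + m + 1) * wp_ratio a b c d (Suc N) = w * (Y / X)"
      using nzm(1) unfolding wp_ratio_Suc w_def[symmetric] m_def[symmetric] X_def Y_def
        B_def[symmetric] C_def[symmetric] D_def[symmetric] by (simp add: mult_ac)
    have t3: "wp_term a b c d N = e * (a + 2 * m) * w"
      by (simp add: wp_term_def e_def m_def w_def)
    have X: "X \<noteq> 0" using nzm by (simp add: X_def)
    have a2: "a + 2 * m = ((b + m) * Q * (a + 1 + 2 * m) + Y + (a - b + m) * X) / X"
      using key X unfolding X_def[symmetric] Q_def[symmetric] Y_def[symmetric]
      by (simp add: field_simps)
    have "e * (a + 2 * m) * w = e * w * (((b + m) * Q * (a + 1 + 2 * m) + Y + (a - b + m) * X) / X)"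
      by (subst a2) simp
    also have "\<dots> = b * Q / P * (e * (a + 1 + 2 * m) * (w * ((b + m) * P / (b * X)))) + e * (w * (Y / X))
        + e * (a - b + m) * w"
      using X nzm(4) nz(1) by (simp add: field_simps)
    finally show ?thesis
      using t1 t2 t3 X unfolding k_def Q_def by (simp add: mult.assoc)
  qed
  moreover have "(\<Sum>n<N. wp_term a b c d n) =
      a - b + k * (\<Sum>n<N. wp_term (a + 1) (b + 1) c d n) - e * (a - b + m) * w"
    using Suc.IH by (simp add: k_def P_def e_def m_def w_def)
  ultimately have "(\<Sum>n<N. wp_term a b c d n) + wp_term a b c d N =
      a - b + k * ((\<Sum>n<N. wp_term (a + 1) (b + 1) c d n) + wp_term (a + 1) (b + 1) c d N)
        - (- e) * (a - b + (m + 1)) * wp_ratio a b c d (Suc N)"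
    by algebra
  thus ?case
    by (simp add: k_def P_def e_def m_def add.commute)
qed

section \<open>Iterating the double shift\<close>

text \<open>
  The constant produced by one double step: that of the first relation plus the multiple of the constant
  \<open>a+1-b\<close> of the second, whose factor \<open>1+a-b\<close> cancels.
\<close>
definition accel_head :: "complex \<Rightarrow> complex \<Rightarrow> complex \<Rightarrow> complex \<Rightarrow> complex" where
  "accel_head a b c d = (1 + 2 * a - b - c - d) -
     (1 + a - b - c) * (1 + a - b - d) * (1 + a - c - d) / ((1 + a - c) * (1 + a - d))"

definition accel_factor :: "complex \<Rightarrow> complex \<Rightarrow> complex \<Rightarrow> complex \<Rightarrow> complex" where
  "accel_factor a b c d =
     - (b * (1 + a - b - c) * (1 + a - b - d) * ((1 + a - c - d) * (2 + a - c - d)) /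
       ((1 + a - b) * ((1 + a - c) * (2 + a - c)) * ((1 + a - d) * (2 + a - d))))"

text \<open>
  Both telescoping relations pass to the limit because the boundary terms vanish; convergence is
  carried backwards, from the shifted sum to the original one.
\<close>
lemma wp_sums_double_shift:
  assumes b: "b \<noteq> 0"
    and nz: "\<And>n::nat. 1 + a - b + of_nat n \<noteq> 0" "\<And>n::nat. 1 + a - c + of_nat n \<noteq> 0"
      "\<And>n::nat. 1 + a - d + of_nat n \<noteq> 0"
    and lim1: "(\<lambda>n. (1 + 2 * a - b - c - d + of_nat n) * wp_ratio a b c d n) \<longlonglongrightarrow> 0"
    and lim2: "(\<lambda>n. (a + 1 - b + of_nat n) * wp_ratio (a + 1) b c d n) \<longlonglongrightarrow> 0"
    and S: "wp_term (a + 2) (b + 1) c d sums S"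
  shows "wp_term a b c d sums (accel_head a b c d + accel_factor a b c d * S)"
proof -
  define Q P q where "Q = (1 + a - b - c) * (1 + a - b - d) * (1 + a - c - d)"
    and "P = (1 + a - b) * (1 + a - c) * (1 + a - d)"
    and "q = b * (1 + (a + 1) - c - d) / ((1 + (a + 1) - c) * (1 + (a + 1) - d))"
  have nz1: "1 + (a + 1) - x + of_nat n \<noteq> 0" if "\<And>n::nat. 1 + a - x + of_nat n \<noteq> 0" for x and n :: nat
    using that[of "Suc n"] by (simp add: algebra_simps)
  have sgn: "(\<lambda>n. (-1) ^ n * f n) \<longlonglongrightarrow> 0" if "f \<longlonglongrightarrow> 0" for f :: "nat \<Rightarrow> complex"
    using that by (intro tendsto_norm_zero_cancel[of "\<lambda>n. (-1) ^ n * f n"])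
      (simp add: norm_mult norm_power tendsto_norm_zero)
  have "(\<lambda>N. (a + 1 - b) + q * (\<Sum>n<N. wp_term (a + 1 + 1) (b + 1) c d n)
       - (-1) ^ N * ((a + 1 - b + of_nat N) * wp_ratio (a + 1) b c d N)) \<longlonglongrightarrow> (a + 1 - b) + q * S - 0"
    using S by (intro tendsto_intros sgn lim2) (simp add: sums_def add.assoc)
  moreover have "(\<Sum>n<N. wp_term (a + 1) b c d n) = (a + 1 - b) + q * (\<Sum>n<N. wp_term (a + 1 + 1) (b + 1) c d n)
       - (-1) ^ N * ((a + 1 - b + of_nat N) * wp_ratio (a + 1) b c d N)" for N
    unfolding q_def using wp_partial_sum_shift_ab[OF b nz1[OF nz(1)] nz1[OF nz(2)] nz1[OF nz(3)], of N]
    by (simp add: mult.assoc)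
  ultimately have S1: "wp_term (a + 1) b c d sums (a + 1 - b + q * S)"
    by (simp add: sums_def)
  have "(\<lambda>N. (1 + 2 * a - b - c - d) - Q / P * (\<Sum>n<N. wp_term (a + 1) b c d n)
       - (-1) ^ N * ((1 + 2 * a - b - c - d + of_nat N) * wp_ratio a b c d N)) \<longlonglongrightarrow>
      (1 + 2 * a - b - c - d) - Q / P * (a + 1 - b + q * S) - 0"
    using S1 by (intro tendsto_intros sgn lim1) (simp add: sums_def)
  moreover have "(\<Sum>n<N. wp_term a b c d n) = (1 + 2 * a - b - c - d) - Q / P * (\<Sum>n<N. wp_term (a + 1) b c d n)
       - (-1) ^ N * ((1 + 2 * a - b - c - d + of_nat N) * wp_ratio a b c d N)" for N
    unfolding Q_def P_def using wp_partial_sum_shift_a[OF nz, of N]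
    by (simp add: mult.assoc)
  ultimately have "wp_term a b c d sums ((1 + 2 * a - b - c - d) - Q / P * (a + 1 - b + q * S))"
    by (simp add: sums_def)
  also have "(1 + 2 * a - b - c - d) - Q / P * (a + 1 - b + q * S) =
      accel_head a b c d + accel_factor a b c d * S"
  proof -
    have "1 + a - b \<noteq> 0" using nz(1)[of 0] by simp
    hence "Q / P * (a + 1 - b) = Q / ((1 + a - c) * (1 + a - d))"
      by (simp add: P_def add.commute)
    moreover have "Q / P * q = - accel_factor a b c d"
      by (simp add: Q_def P_def q_def accel_factor_def mult_ac add_ac)
    ultimately show ?thesis
      by (simp add: accel_head_def Q_def distrib_left mult.assoc[symmetric])
  qed
  finally show ?thesis .
qed

text \<open>
  The product of the factors of the first \<open>k\<close> double steps, in closed form (\<open>accel_coeff_Suc\<close>).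
\<close>
definition accel_coeff :: "complex \<Rightarrow> complex \<Rightarrow> complex \<Rightarrow> complex \<Rightarrow> nat \<Rightarrow> complex" where
  "accel_coeff a b c d k = (-1) ^ k *
     (pochhammer b k * pochhammer (1 + a - b - c) k * pochhammer (1 + a - b - d) k *
       pochhammer (1 + a - c - d) (2 * k)) /
     (pochhammer (1 + a - b) k * pochhammer (1 + a - c) (2 * k) * pochhammer (1 + a - d) (2 * k))"

lemma pochhammer_double_Suc:
  "pochhammer (x :: complex) (2 * Suc k) =
     pochhammer x (2 * k) * ((x + of_nat (2 * k)) * (x + of_nat (2 * k) + 1))"
  by (simp add: pochhammer_Suc algebra_simps)

lemma accel_coeff_0 [simp]: "accel_coeff a b c d 0 = 1"
  by (simp add: accel_coeff_def)

lemma accel_coeff_Suc: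
  "accel_coeff a b c d (Suc k) =
     accel_coeff a b c d k * accel_factor (a + 2 * of_nat k) (b + of_nat k) c d"
proof -
  define k1 k2 :: complex where "k1 = of_nat k" and "k2 = of_nat (2 * k)"
  have sh3: "1 + (a + 2 * of_nat k) - (b + of_nat k) - c = 1 + a - b - c + k1"
    "1 + (a + 2 * of_nat k) - (b + of_nat k) - d = 1 + a - b - d + k1"
    "1 + (a + 2 * of_nat k) - c - d = 1 + a - c - d + k2"
    "2 + (a + 2 * of_nat k) - c - d = 1 + a - c - d + k2 + 1"
    by (simp_all add: k1_def k2_def)
  have sh2: "1 + (a + 2 * of_nat k) - (b + of_nat k) = 1 + a - b + k1"
    "1 + (a + 2 * of_nat k) - c = 1 + a - c + k2" "1 + (a + 2 * of_nat k) - d = 1 + a - d + k2"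
    "2 + (a + 2 * of_nat k) - c = 1 + a - c + k2 + 1" "2 + (a + 2 * of_nat k) - d = 1 + a - d + k2 + 1"
    by (simp_all add: k1_def k2_def)
  define p1 p2 p3 p4 p5 p6 p7 where "p1 = b + k1" and "p2 = 1 + a - b - c + k1"
    and "p3 = 1 + a - b - d + k1"
    and "p4 = (1 + a - c - d + k2) * (1 + a - c - d + k2 + 1)"
    and "p5 = 1 + a - b + k1" and "p6 = (1 + a - c + k2) * (1 + a - c + k2 + 1)"
    and "p7 = (1 + a - d + k2) * (1 + a - d + k2 + 1)"
  note p = p1_def p2_def p3_def p4_def p5_def p6_def p7_def
  define q1 q2 q3 q4 q5 q6 q7 where "q1 = pochhammer b k" and "q2 = pochhammer (1 + a - b - c) k"
    and "q3 = pochhammer (1 + a - b - d) k" and "q4 = pochhammer (1 + a - c - d) (2 * k)"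
    and "q5 = pochhammer (1 + a - b) k" and "q6 = pochhammer (1 + a - c) (2 * k)"
    and "q7 = pochhammer (1 + a - d) (2 * k)"
  note q = q1_def q2_def q3_def q4_def q5_def q6_def q7_def
  have 1: "accel_factor (a + 2 * of_nat k) (b + of_nat k) c d =
      - (p1 * p2 * p3 * p4 / (p5 * p6 * p7))"
    unfolding accel_factor_def sh3 unfolding sh2 p by (simp only: k1_def)
  have 2: "accel_coeff a b c d k = (-1) ^ k * (q1 * q2 * q3 * q4) / (q5 * q6 * q7)"
    unfolding accel_coeff_def q ..
  have 3: "accel_coeff a b c d (Suc k) = (-1) ^ Suc k * ((q1 * p1) * (q2 * p2) * (q3 * p3) * (q4 * p4)) /
      ((q5 * p5) * (q6 * p6) * (q7 * p7))"
    unfolding accel_coeff_def pochhammer_double_Suc pochhammer_Suc q p k1_def k2_def ..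
  show ?thesis
    unfolding 1 2 3 by (simp add: mult_ac)
qed

section \<open>Estimates near the central parameters\<close>

text \<open>
  A fixed polydisc around \<open>a = 1\<close>, \<open>b = c = d = 1/2\<close>. The radius is small enough to pair
  numerator factors with larger denominator factors, uniformly in the number of steps; being
  positive, it leaves room for differentiation at the centre.
\<close>
definition near_central :: "complex \<Rightarrow> complex \<Rightarrow> complex \<Rightarrow> complex \<Rightarrow> bool" where
  "near_central a b c d \<longleftrightarrow> norm (a - 1) \<le> 1/20 \<and> norm (b - 1/2) \<le> 1/20 \<and>
     norm (c - 1/2) \<le> 1/20 \<and> norm (d - 1/2) \<le> 1/20"

lemma norm_near_real:
  fixes z :: complex
  assumes "norm (z - of_real x) \<le> e" "0 \<le> x"
  shows "norm z \<le> x + e" "x - e \<le> norm z"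
proof -
  have x: "norm (of_real x :: complex) = x" using assms by simp
  show "norm z \<le> x + e"
    using norm_triangle_ineq[of "z - of_real x" "of_real x"] assms x by simp
  show "x - e \<le> norm z"
    using norm_triangle_ineq2[of "of_real x" z] assms x by (simp add: norm_minus_commute)
qed

lemma near_central_bounds:
  assumes "near_central a b c d"
  shows "norm (b + of_nat k + of_nat n) \<le> real k + real n + 11/20"
    "norm (c + of_nat n) \<le> real n + 11/20"
    "norm (d + of_nat n) \<le> real n + 11/20"
    "real k + real n + 7/5 \<le> norm (1 + (a + 2 * of_nat k) - (b + of_nat k) + of_nat n)"
    "2 * real k + real n + 7/5 \<le> norm (1 + (a + 2 * of_nat k) - c + of_nat n)"
    "2 * real k + real n + 7/5 \<le> norm (1 + (a + 2 * of_nat k) - d + of_nat n)"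
    "norm (1 + (a + 2 * of_nat k) - (b + of_nat k) - c) \<le> real k + 23/20"
    "norm (1 + (a + 2 * of_nat k) - (b + of_nat k) - d) \<le> real k + 23/20"
    "norm (1 + (a + 2 * of_nat k) - c - d) \<le> 2 * real k + 23/20"
    "norm (2 + (a + 2 * of_nat k) - c - d) \<le> 2 * real k + 43/20"
    "norm (1 + 2 * (a + 2 * of_nat k) - (b + of_nat k) - c - d) \<le> 3 * real k + 7/4"
    "norm (a + 2 * of_nat k) \<le> 2 * real k + 21/20"
    "9/20 \<le> norm b" "9/20 \<le> norm c" "9/20 \<le> norm d"
proof -
  define p q r s where "p = a - 1" and "q = b - 1/2" and "r = c - 1/2" and "s = d - 1/2"
  have abcd: "a = 1 + p" "b = 1/2 + q" "c = 1/2 + r" "d = 1/2 + s"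
    by (simp_all add: p_def q_def r_def s_def)
  have n: "norm p \<le> 1/20" "norm q \<le> 1/20" "norm r \<le> 1/20" "norm s \<le> 1/20"
    using assms by (simp_all add: near_central_def p_def q_def r_def s_def)
  have sub2: "norm (x - y) \<le> e + e'" if "norm x \<le> e" "norm y \<le> e'" for x y :: complex and e e'
    using norm_triangle_ineq4[of x y] that by linarith
  have add2: "norm (x + y) \<le> e + e'" if "norm x \<le> e" "norm y \<le> e'" for x y :: complex and e e'
    using norm_triangle_ineq[of x y] that by linarith
  have pq: "norm (p - q) \<le> 1/10" "norm (p - r) \<le> 1/10" "norm (p - s) \<le> 1/10"
    using sub2[OF n(1) n(2)] sub2[OF n(1) n(3)] sub2[OF n(1) n(4)] by simp_all
  have pqr: "norm (p - q - r) \<le> 3/20" "norm (p - q - s) \<le> 3/20" "norm (p - r - s) \<le> 3/20"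
    using sub2[OF pq(1) n(3)] sub2[OF pq(1) n(4)] sub2[OF pq(2) n(4)] by simp_all
  have all: "norm (p + p - q - r - s) \<le> 5/20"
    using sub2[OF add2[OF n(1) pqr(1)] n(4)] by (simp add: algebra_simps)
  show "norm (b + of_nat k + of_nat n) \<le> real k + real n + 11/20"
    using norm_near_real(1)[of "b + of_nat k + of_nat n" "real k + real n + 1/2" "1/20"] n
    by (simp add: abcd algebra_simps)
  show "norm (c + of_nat n) \<le> real n + 11/20"
    using norm_near_real(1)[of "c + of_nat n" "real n + 1/2" "1/20"] n
    by (simp add: abcd algebra_simps)
  show "norm (d + of_nat n) \<le> real n + 11/20"
    using norm_near_real(1)[of "d + of_nat n" "real n + 1/2" "1/20"] n
    by (simp add: abcd algebra_simps)
  show "real k + real n + 7/5 \<le> norm (1 + (a + 2 * of_nat k) - (b + of_nat k) + of_nat n)"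
    using norm_near_real(2)[of "1 + (a + 2 * of_nat k) - (b + of_nat k) + of_nat n" "real k + real n + 3/2" "1/10"] pq
    by (simp add: abcd algebra_simps)
  show "2 * real k + real n + 7/5 \<le> norm (1 + (a + 2 * of_nat k) - c + of_nat n)"
    using norm_near_real(2)[of "1 + (a + 2 * of_nat k) - c + of_nat n" "2 * real k + real n + 3/2" "1/10"] pq
    by (simp add: abcd algebra_simps)
  show "2 * real k + real n + 7/5 \<le> norm (1 + (a + 2 * of_nat k) - d + of_nat n)"
    using norm_near_real(2)[of "1 + (a + 2 * of_nat k) - d + of_nat n" "2 * real k + real n + 3/2" "1/10"] pq
    by (simp add: abcd algebra_simps)
  show "norm (1 + (a + 2 * of_nat k) - (b + of_nat k) - c) \<le> real k + 23/20"
    using norm_near_real(1)[of "1 + (a + 2 * of_nat k) - (b + of_nat k) - c" "real k + 1" "3/20"] pqr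
    by (simp add: abcd algebra_simps)
  show "norm (1 + (a + 2 * of_nat k) - (b + of_nat k) - d) \<le> real k + 23/20"
    using norm_near_real(1)[of "1 + (a + 2 * of_nat k) - (b + of_nat k) - d" "real k + 1" "3/20"] pqr
    by (simp add: abcd algebra_simps)
  show "norm (1 + (a + 2 * of_nat k) - c - d) \<le> 2 * real k + 23/20"
    using norm_near_real(1)[of "1 + (a + 2 * of_nat k) - c - d" "2 * real k + 1" "3/20"] pqr
    by (simp add: abcd algebra_simps)
  show "norm (2 + (a + 2 * of_nat k) - c - d) \<le> 2 * real k + 43/20"
    using norm_near_real(1)[of "2 + (a + 2 * of_nat k) - c - d" "2 * real k + 2" "3/20"] pqr
    by (simp add: abcd algebra_simps)
  show "norm (1 + 2 * (a + 2 * of_nat k) - (b + of_nat k) - c - d) \<le> 3 * real k + 7/4"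
    using norm_near_real(1)[of "1 + 2 * (a + 2 * of_nat k) - (b + of_nat k) - c - d" "3 * real k + 3/2" "5/20"] all
    by (simp add: abcd algebra_simps)
  show "norm (a + 2 * of_nat k) \<le> 2 * real k + 21/20"
    using norm_near_real(1)[of "a + 2 * of_nat k" "2 * real k + 1" "1/20"] n
    by (simp add: abcd algebra_simps)
  show "9/20 \<le> norm b" "9/20 \<le> norm c" "9/20 \<le> norm d"
    using norm_near_real(2)[of b "1/2" "1/20"] norm_near_real(2)[of c "1/2" "1/20"]
      norm_near_real(2)[of d "1/2" "1/20"] n by (simp_all add: abcd)
qed

lemma norm_pochhammer_ratio_Suc:
  fixes x y :: complex
  shows "norm (pochhammer x (Suc n) / pochhammer y (Suc n)) =
     norm (pochhammer x n / pochhammer y n) * (norm (x + of_nat n) / norm (y + of_nat n))"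
  by (simp add: pochhammer_Suc norm_mult norm_divide)

lemma norm_pochhammer_ratio_le_1:
  fixes x y :: complex
  assumes "\<And>j::nat. norm (x + of_nat j) \<le> norm (y + of_nat j)"
  shows "norm (pochhammer x n / pochhammer y n) \<le> 1"
proof (induction n)
  case (Suc n)
  have "norm (x + of_nat n) / norm (y + of_nat n) \<le> 1"
    using assms[of n] by (simp add: divide_le_eq_1 not_less)
  thus ?case unfolding norm_pochhammer_ratio_Suc using Suc by (intro mult_le_one) auto
qed simp

text \<open>
  The bounding quotients \<open>(j+1)/(j+2)\<close> telescope; a gap of two gives quadratic decay in the same way
  (\<open>norm_pochhammer_ratio_gap_2\<close>).
\<close>
lemma norm_pochhammer_ratio_gap_1:
  fixes x y :: complex
  assumes "\<And>j::nat. norm (x + of_nat j) \<le> real j + 1" "\<And>j::nat. real j + 2 \<le> norm (y + of_nat j)"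
  shows "norm (pochhammer x n / pochhammer y n) \<le> 1 / (real n + 1)"
proof (induction n)
  case (Suc n)
  have "norm (x + of_nat n) / norm (y + of_nat n) \<le> (real n + 1) / (real n + 2)"
    using assms[of n] by (intro frac_le) auto
  hence "norm (pochhammer x (Suc n) / pochhammer y (Suc n)) \<le>
      1 / (real n + 1) * ((real n + 1) / (real n + 2))"
    unfolding norm_pochhammer_ratio_Suc using Suc by (intro mult_mono) auto
  also have "\<dots> = 1 / (real (Suc n) + 1)" by simp
  finally show ?case .
qed simp

lemma norm_pochhammer_ratio_gap_2:
  fixes x y :: complex
  assumes "\<And>j::nat. norm (x + of_nat j) \<le> real j + 1" "\<And>j::nat. real j + 3 \<le> norm (y + of_nat j)"
  shows "norm (pochhammer x n / pochhammer y n) \<le> 2 / ((real n + 1) * (real n + 2))"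
proof (induction n)
  case (Suc n)
  have "norm (x + of_nat n) / norm (y + of_nat n) \<le> (real n + 1) / (real n + 3)"
    using assms[of n] by (intro frac_le) auto
  hence "norm (pochhammer x (Suc n) / pochhammer y (Suc n)) \<le>
      2 / ((real n + 1) * (real n + 2)) * ((real n + 1) / (real n + 3))"
    unfolding norm_pochhammer_ratio_Suc using Suc by (intro mult_mono) auto
  also have "\<dots> = 2 / ((real (Suc n) + 1) * (real (Suc n) + 2))"
  proof -
    have "2 / (p * q) * (p / r) = 2 / (q * r)" if "p > 0" for p q r :: real
      using that by simp
    from this[of "real n + 1" "real n + 2" "real n + 3"] show ?thesis
      by (simp add: algebra_simps)
  qed
  finally show ?case .
qed simp

lemma wp_ratio_eq:
  "wp_ratio a b c d n = pochhammer b n / pochhammer (1 + a - b) n *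
     (pochhammer c n / pochhammer (1 + a - c) n) * (pochhammer d n / pochhammer (1 + a - d) n)"
  by (simp add: wp_ratio_def)

lemma wp_ratio_tendsto:
  assumes "\<And>j::nat. norm (b + of_nat j) \<le> norm (1 + a - b + of_nat j)"
    and "\<And>j::nat. norm (c + of_nat j) \<le> real j + 1" "\<And>j::nat. real j + 2 \<le> norm (1 + a - c + of_nat j)"
    and "\<And>j::nat. norm (d + of_nat j) \<le> real j + 1" "\<And>j::nat. real j + 2 \<le> norm (1 + a - d + of_nat j)"
  shows "(\<lambda>n. (s + of_nat n) * wp_ratio a b c d n) \<longlonglongrightarrow> 0"
proof (rule Lim_null_comparison)
  show "(\<lambda>n. (norm s + 1) / (real n + 1)) \<longlonglongrightarrow> 0"
    by real_asymp
  show "\<forall>\<^sub>F n in sequentially. norm ((s + of_nat n) * wp_ratio a b c d n) \<le> (norm s + 1) / (real n + 1)"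
  proof (intro always_eventually allI)
    fix n :: nat
    have 1: "norm (wp_ratio a b c d n) \<le> 1 * (1 / (real n + 1)) * (1 / (real n + 1))"
      unfolding wp_ratio_eq norm_mult
      by (intro mult_mono norm_pochhammer_ratio_le_1 norm_pochhammer_ratio_gap_1 assms) auto
    have "norm (s + of_nat n) \<le> norm s + real n"
      using norm_triangle_ineq[of s "of_nat n"] by simp
    also have "\<dots> \<le> (norm s + 1) * (real n + 1)"
      by (simp add: algebra_simps)
    finally have "norm ((s + of_nat n) * wp_ratio a b c d n) \<le>
        ((norm s + 1) * (real n + 1)) * (1 * (1 / (real n + 1)) * (1 / (real n + 1)))"
      unfolding norm_mult using 1 by (intro mult_mono) auto
    thus "norm ((s + of_nat n) * wp_ratio a b c d n) \<le> (norm s + 1) / (real n + 1)"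
      by simp
  qed
qed

definition wp_tail :: "complex \<Rightarrow> complex \<Rightarrow> complex \<Rightarrow> complex \<Rightarrow> nat \<Rightarrow> complex" where
  "wp_tail a b c d k = (\<Sum>n. wp_term (a + 2 * of_nat k) (b + of_nat k) c d n)"

text \<open>
  After at least one double step the parameters \<open>c\<close>, \<open>d\<close> lie more than \<open>2\<close> below their denominator
  partners, so the terms are \<open>O((k+1) (n+1)^{-2})\<close>; the tail grows at most linearly in \<open>k\<close>.
\<close>
lemma wp_tail_bound:
  assumes near: "near_central a b c d" and k: "k \<ge> 1"
  shows "wp_term (a + 2 * of_nat k) (b + of_nat k) c d sums wp_tail a b c d k"
    and "norm (wp_tail a b c d k) \<le> 8 * (real k + 1) * (\<Sum>n. 1 / (real n + 1) ^ 2)"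
proof -
  note bds = near_central_bounds[OF near]
  define h where "h n = 8 * (real k + 1) * (1 / (real n + 1) ^ 2)" for n
  have sq: "summable (\<lambda>n. 1 / (real n + 1) ^ 2)"
    using inverse_squares_sums by (simp add: sums_iff add.commute)
  have bd: "norm (wp_term (a + 2 * of_nat k) (b + of_nat k) c d n) \<le> h n" for n
  proof -
    have *: "norm (wp_ratio (a + 2 * of_nat k) (b + of_nat k) c d n) \<le>
        1 * (2 / ((real n + 1) * (real n + 2))) * (2 / ((real n + 1) * (real n + 2)))"
      unfolding wp_ratio_eq norm_mult
    proof (intro mult_mono norm_pochhammer_ratio_le_1 norm_pochhammer_ratio_gap_2)
      fix j :: nat
      show "norm (b + of_nat k + of_nat j) \<le> norm (1 + (a + 2 * of_nat k) - (b + of_nat k) + of_nat j)"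
        using bds(1)[of k j] bds(4)[of k j] by linarith
      show "norm (c + of_nat j) \<le> real j + 1" "norm (d + of_nat j) \<le> real j + 1"
        using bds(2,3)[of j] by linarith+
      show "real j + 3 \<le> norm (1 + (a + 2 * of_nat k) - c + of_nat j)"
        "real j + 3 \<le> norm (1 + (a + 2 * of_nat k) - d + of_nat j)"
        using bds(5,6)[of k j] k by linarith+
    qed auto
    also have "\<dots> \<le> 1 * (2 / ((real n + 1) * 1)) * (2 / ((real n + 1) * (real n + 1)))"
      by (intro mult_mono divide_left_mono mult_pos_pos) auto
    finally have 1: "norm (wp_ratio (a + 2 * of_nat k) (b + of_nat k) c d n) \<le>
        4 / ((real n + 1) * (real n + 1) ^ 2)"
      by (simp add: power2_eq_square mult_ac)
    have "norm (a + 2 * of_nat k + 2 * of_nat n) \<le> norm (a + 2 * of_nat k) + 2 * real n"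
      using norm_triangle_ineq[of "a + 2 * of_nat k" "2 * of_nat n"] by (simp add: norm_mult)
    also have "\<dots> \<le> 2 * (real k + 1) * (real n + 1)"
    proof -
      have "2 * (real k + 1) * (real n + 1) = 2 * real k + 2 + 2 * real n + 2 * (real k * real n)"
        by (simp add: algebra_simps)
      moreover have "0 \<le> real k * real n" by simp
      ultimately show ?thesis using bds(12)[of k] by linarith
    qed
    finally have 2: "norm (a + 2 * of_nat k + 2 * of_nat n) \<le> 2 * (real k + 1) * (real n + 1)" .
    have "norm (wp_term (a + 2 * of_nat k) (b + of_nat k) c d n) =
        norm (a + 2 * of_nat k + 2 * of_nat n) * norm (wp_ratio (a + 2 * of_nat k) (b + of_nat k) c d n)"
      by (simp add: wp_term_def norm_mult norm_power)
    also have "\<dots> \<le> 2 * (real k + 1) * (real n + 1) * (4 / ((real n + 1) * (real n + 1) ^ 2))"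
      by (rule mult_mono[OF 2 1]) auto
    also have "\<dots> = h n" by (simp add: h_def)
    finally show ?thesis .
  qed
  have sh: "summable h" unfolding h_def by (intro summable_mult sq)
  have sn: "summable (\<lambda>n. norm (wp_term (a + 2 * of_nat k) (b + of_nat k) c d n))"
    by (rule summable_comparison_test'[OF sh, of 0]) (use bd in auto)
  show "wp_term (a + 2 * of_nat k) (b + of_nat k) c d sums wp_tail a b c d k"
    unfolding wp_tail_def using summable_norm_cancel[OF sn] by (rule summable_sums)
  have "norm (wp_tail a b c d k) \<le> (\<Sum>n. h n)"
    unfolding wp_tail_def by (rule norm_suminf_le[OF bd sh])
  also have "\<dots> = 8 * (real k + 1) * (\<Sum>n. 1 / (real n + 1) ^ 2)"
    unfolding h_def by (rule suminf_mult[OF sq])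
  finally show "norm (wp_tail a b c d k) \<le> 8 * (real k + 1) * (\<Sum>n. 1 / (real n + 1) ^ 2)" .
qed

text \<open>
  The five quotients of a step factor are each at most \<open>1\<close>, and \<open>(1+a-b-c)/(2+a-c)\<close>, which
  is about \<open>(k+1)/(2k+5/2)\<close> after \<open>k\<close> steps, is at most \<open>1/2\<close>.
\<close>
lemma norm_accel_coeff_le:
  assumes near: "near_central a b c d"
  shows "norm (accel_coeff a b c d k) \<le> (1/2) ^ k"
proof (induction k)
  case (Suc k)
  note bds = near_central_bounds[OF near]
  let ?a = "a + 2 * of_nat k" and ?b = "b + of_nat k"
  have *: "norm x / norm y \<le> q" if "norm x \<le> e" "e \<le> q * f" "f \<le> norm y" "f > 0" "0 \<le> q"
    for x y :: complex and e f q
    using that by (simp add: divide_le_eq) (meson order_trans mult_left_mono)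
  have "norm (accel_factor ?a ?b c d) =
      norm ?b / norm (1 + ?a - ?b) * (norm (1 + ?a - ?b - c) / norm (2 + ?a - c)) *
      (norm (1 + ?a - ?b - d) / norm (1 + ?a - c)) *
      (norm (1 + ?a - c - d) / norm (1 + ?a - d)) * (norm (2 + ?a - c - d) / norm (2 + ?a - d))"
    by (simp add: accel_factor_def norm_mult norm_divide mult_ac)
  also have "\<dots> \<le> 1 * (1/2) * 1 * 1 * 1"
  proof (intro mult_mono)
    show "norm ?b / norm (1 + ?a - ?b) \<le> 1"
      by (rule *[of _ "real k + 11/20" _ "real k + 7/5"]) (use bds(1)[of k 0] bds(4)[of k 0] in auto)
    show "norm (1 + ?a - ?b - c) / norm (2 + ?a - c) \<le> 1/2"
      by (rule *[of _ "real k + 23/20" _ "2 * real k + 12/5"])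
        (use bds(7)[of k] bds(5)[of k 1] in \<open>auto simp: algebra_simps\<close>)
    show "norm (1 + ?a - ?b - d) / norm (1 + ?a - c) \<le> 1"
      by (rule *[of _ "real k + 23/20" _ "2 * real k + 7/5"]) (use bds(8)[of k] bds(5)[of k 0] in auto)
    show "norm (1 + ?a - c - d) / norm (1 + ?a - d) \<le> 1"
      by (rule *[of _ "2 * real k + 23/20" _ "2 * real k + 7/5"]) (use bds(9)[of k] bds(6)[of k 0] in auto)
    show "norm (2 + ?a - c - d) / norm (2 + ?a - d) \<le> 1"
      by (rule *[of _ "2 * real k + 43/20" _ "2 * real k + 12/5"])
        (use bds(10)[of k] bds(6)[of k 1] in \<open>auto simp: algebra_simps\<close>)
  qed auto
  finally have "norm (accel_factor ?a ?b c d) \<le> 1/2" by simp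
  hence "norm (accel_coeff a b c d (Suc k)) \<le> (1/2) ^ k * (1/2)"
    unfolding accel_coeff_Suc norm_mult using Suc by (intro mult_mono) auto
  thus ?case by simp
qed simp

lemma norm_accel_head_le:
  assumes near: "near_central a b c d"
  shows "norm (accel_head (a + 2 * of_nat k) (b + of_nat k) c d) \<le> 5 * (real k + 1)"
proof -
  note bds = near_central_bounds[OF near]
  let ?a = "a + 2 * of_nat k" and ?b = "b + of_nat k"
  have *: "norm x / norm y \<le> 1" if "norm x \<le> e" "e \<le> f" "f \<le> norm y" "f > 0"
    for x y :: complex and e f
    using that by (simp add: divide_le_eq)
  have "norm ((1 + ?a - ?b - c) * (1 + ?a - ?b - d) * (1 + ?a - c - d) / ((1 + ?a - c) * (1 + ?a - d)))
     = norm (1 + ?a - ?b - c) / norm (1 + ?a - c) * (norm (1 + ?a - ?b - d) / norm (1 + ?a - d)) *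
        norm (1 + ?a - c - d)"
    by (simp add: norm_mult norm_divide)
  also have "\<dots> \<le> 1 * 1 * (2 * real k + 23/20)"
  proof (intro mult_mono)
    show "norm (1 + ?a - ?b - c) / norm (1 + ?a - c) \<le> 1"
      by (rule *[of _ "real k + 23/20" "2 * real k + 7/5"]) (use bds(7)[of k] bds(5)[of k 0] in auto)
    show "norm (1 + ?a - ?b - d) / norm (1 + ?a - d) \<le> 1"
      by (rule *[of _ "real k + 23/20" "2 * real k + 7/5"]) (use bds(8)[of k] bds(6)[of k 0] in auto)
  qed (use bds(9)[of k] in auto)
  finally have Q: "norm ((1 + ?a - ?b - c) * (1 + ?a - ?b - d) * (1 + ?a - c - d) /
      ((1 + ?a - c) * (1 + ?a - d))) \<le> 2 * real k + 23/20" by simp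
  have "norm (accel_head ?a ?b c d) \<le> (3 * real k + 7/4) + (2 * real k + 23/20)"
    unfolding accel_head_def
    by (rule order_trans[OF norm_triangle_ineq4 add_mono[OF bds(11) Q]])
  thus ?thesis by simp
qed

text \<open>
  The remainder after \<open>K\<close> double steps is a coefficient of size \<open>2^{-K}\<close> times a tail of size
  \<open>O(K)\<close>. The first step alone needs the hypothesis on the boundary term, since there the
  gap between \<open>c\<close>, \<open>d\<close> and their denominator partners is only about one.
\<close>
theorem wp_accelerated_sums:
  assumes near: "near_central a b c d"
    and lim: "(\<lambda>n. (1 + 2 * a - b - c - d + of_nat n) * wp_ratio a b c d n) \<longlonglongrightarrow> 0"
    and S: "wp_term a b c d sums S"
  shows "(\<lambda>k. accel_coeff a b c d k * accel_head (a + 2 * of_nat k) (b + of_nat k) c d) sums S"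
proof -
  note bds = near_central_bounds[OF near]
  have pos: "z \<noteq> 0" if "r \<le> norm z" "r > 0" for z :: complex and r
    using that by auto
  have shift: "wp_tail a b c d k = accel_head (a + 2 * of_nat k) (b + of_nat k) c d +
      accel_factor (a + 2 * of_nat k) (b + of_nat k) c d * wp_tail a b c d (Suc k)" for k
  proof -
    let ?a = "a + 2 * of_nat k" and ?b = "b + of_nat k"
    have "wp_term ?a ?b c d sums (accel_head ?a ?b c d + accel_factor ?a ?b c d * wp_tail a b c d (Suc k))"
    proof (rule wp_sums_double_shift)
      show "?b \<noteq> 0"
      proof (cases k)
        case 0
        thus ?thesis using bds(13) by (intro pos) auto
      next
        case (Suc m)
        have "norm (?b - of_real (real k + 1/2)) \<le> 1/20"
          using near by (simp add: near_central_def)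
        from norm_near_real(2)[OF this] show ?thesis by (intro pos) auto
      qed
      show "1 + ?a - ?b + of_nat n \<noteq> 0" "1 + ?a - c + of_nat n \<noteq> 0" "1 + ?a - d + of_nat n \<noteq> 0" for n
        using pos[OF bds(4)[of k n]] pos[OF bds(5)[of k n]] pos[OF bds(6)[of k n]] by auto
      show "(\<lambda>n. (1 + 2 * ?a - ?b - c - d + of_nat n) * wp_ratio ?a ?b c d n) \<longlonglongrightarrow> 0"
      proof (cases "k = 0")
        case False
        show ?thesis
        proof (rule wp_ratio_tendsto)
          fix j :: nat
          show "norm (?b + of_nat j) \<le> norm (1 + ?a - ?b + of_nat j)"
            using bds(1)[of k j] bds(4)[of k j] by linarith
          show "norm (c + of_nat j) \<le> real j + 1" "norm (d + of_nat j) \<le> real j + 1"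
            using bds(2,3)[of j] by linarith+
          show "real j + 2 \<le> norm (1 + ?a - c + of_nat j)" "real j + 2 \<le> norm (1 + ?a - d + of_nat j)"
            using bds(5,6)[of k j] False by linarith+
        qed
      qed (use lim in simp)
      show "(\<lambda>n. (?a + 1 - ?b + of_nat n) * wp_ratio (?a + 1) ?b c d n) \<longlonglongrightarrow> 0"
      proof (rule wp_ratio_tendsto)
        fix j :: nat
        have eq: "1 + (?a + 1) - x + of_nat j = 1 + ?a - x + of_nat (Suc j)" for x
          by (simp add: algebra_simps)
        show "norm (?b + of_nat j) \<le> norm (1 + (?a + 1) - ?b + of_nat j)"
          unfolding eq using bds(1)[of k j] bds(4)[of k "Suc j"] by simp
        show "norm (c + of_nat j) \<le> real j + 1" "norm (d + of_nat j) \<le> real j + 1"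
          using bds(2,3)[of j] by linarith+
        show "real j + 2 \<le> norm (1 + (?a + 1) - c + of_nat j)"
          "real j + 2 \<le> norm (1 + (?a + 1) - d + of_nat j)"
          unfolding eq using bds(5,6)[of k "Suc j"] by simp_all
      qed
      have "?a + 2 = a + 2 * of_nat (Suc k)" "?b + 1 = b + of_nat (Suc k)" by simp_all
      thus "wp_term (?a + 2) (?b + 1) c d sums wp_tail a b c d (Suc k)"
        using wp_tail_bound(1)[OF near, of "Suc k"] by (simp only:)
    qed
    thus ?thesis by (simp add: wp_tail_def sums_iff)
  qed
  have S0: "S = wp_tail a b c d 0"
    using S by (simp add: wp_tail_def sums_iff)
  have part: "(\<Sum>k<K. accel_coeff a b c d k * accel_head (a + 2 * of_nat k) (b + of_nat k) c d)
      = S - accel_coeff a b c d K * wp_tail a b c d K" for K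
  proof (induction K)
    case (Suc K)
    show ?case
      unfolding sum.lessThan_Suc Suc accel_coeff_Suc by (subst shift) (simp add: algebra_simps)
  qed (simp add: S0)
  define Z where "Z = (\<Sum>n. 1 / (real n + 1) ^ 2)"
  have "(\<lambda>K. accel_coeff a b c d K * wp_tail a b c d K) \<longlonglongrightarrow> 0"
  proof (rule Lim_null_comparison)
    show "(\<lambda>K. (1/2) ^ K * (8 * (real K + 1) * Z)) \<longlonglongrightarrow> 0"
      by real_asymp
    show "\<forall>\<^sub>F K in sequentially. norm (accel_coeff a b c d K * wp_tail a b c d K) \<le>
        (1/2) ^ K * (8 * (real K + 1) * Z)"
      using eventually_ge_at_top[of 1]
      by eventually_elim
        (unfold norm_mult Z_def, intro mult_mono norm_accel_coeff_le[OF near] wp_tail_bound(2)[OF near], auto)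
  qed
  hence "(\<lambda>K. S - accel_coeff a b c d K * wp_tail a b c d K) \<longlonglongrightarrow> S - 0"
    by (intro tendsto_intros)
  thus ?thesis by (simp add: sums_def part)
qed

section \<open>The value of the beta function at three\<close>

lemma dirichlet_beta_sums:
  assumes "s \<ge> 2"
  shows "(\<lambda>n. (-1) ^ n / (2 * real n + 1) ^ s) sums dirichlet_beta s"
proof -
  have "summable (\<lambda>n. 1 / (real n + 1) ^ s)"
    using inverse_power_summable[OF assms, where 'a = real]
    by (subst (asm) summable_Suc_iff[symmetric]) (simp add: field_simps)
  hence "summable (\<lambda>n. (-1) ^ n / (2 * real n + 1) ^ s)"
    by (rule summable_comparison_test'[of _ 0]) (auto intro!: divide_left_mono power_mono simp: norm_divide norm_power)
  thus ?thesis unfolding dirichlet_beta_def by (rule summable_sums)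
qed

text \<open>
  Logarithmic differentiation of the reflection formula for \<open>\<Gamma>\<close>.
\<close>
lemma Digamma_reflection:
  fixes x :: real
  assumes "0 < x" "x < 1"
  shows "Polygamma 0 (1 - x) - Polygamma 0 x = pi * cot (pi * x)"
proof -
  have refl: "Gamma t * Gamma (1 - t) = pi / sin (pi * t)" for t :: real
  proof -
    have "of_real (Gamma t * Gamma (1 - t)) = (of_real (pi / sin (pi * t)) :: complex)"
      using Gamma_reflection_complex[of "of_real t"]
      by (simp flip: Gamma_complex_of_real sin_of_real)
    thus ?thesis using of_real_eq_iff by blast
  qed
  have nonpos: "x \<notin> \<int>\<^sub>\<le>\<^sub>0" "1 - x \<notin> \<int>\<^sub>\<le>\<^sub>0"
    using assms by (auto elim!: nonpos_Ints_cases)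
  have sin: "sin (pi * x) > 0"
    using assms by (intro sin_gt_zero) auto
  have "((\<lambda>t. Gamma t * Gamma (1 - t)) has_field_derivative
      Gamma x * Gamma (1 - x) * (Polygamma 0 x - Polygamma 0 (1 - x))) (at x)"
    using nonpos by (auto intro!: derivative_eq_intros simp: algebra_simps)
  moreover have "((\<lambda>t. pi / sin (pi * t)) has_field_derivative
      - pi * (pi * cos (pi * x)) / sin (pi * x) ^ 2) (at x)"
    using sin by (auto intro!: derivative_eq_intros simp: power2_eq_square)
  ultimately have "Gamma x * Gamma (1 - x) * (Polygamma 0 x - Polygamma 0 (1 - x)) =
      - pi * (pi * cos (pi * x)) / sin (pi * x) ^ 2"
    using DERIV_unique unfolding refl by blast
  hence "(pi / sin (pi * x)) * (Polygamma 0 (1 - x) - Polygamma 0 x) =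
      (pi / sin (pi * x)) * (pi * cot (pi * x))"
    unfolding refl by (simp add: cot_def power2_eq_square algebra_simps)
  thus ?thesis using sin by simp
qed

lemma Polygamma_2_reflection:
  fixes x :: real
  assumes "0 < x" "x < 1"
  shows "Polygamma 2 (1 - x) - Polygamma 2 x = 2 * pi ^ 3 * cos (pi * x) / sin (pi * x) ^ 3"
proof -
  have nonpos: "t \<notin> \<int>\<^sub>\<le>\<^sub>0" "1 - t \<notin> \<int>\<^sub>\<le>\<^sub>0" if "t \<in> {0<..<1}" for t :: real
    using that by (auto elim!: nonpos_Ints_cases)
  have sin: "sin (pi * t) > 0" if "t \<in> {0<..<1}" for t
    using that by (intro sin_gt_zero) auto
  have 1: "Polygamma 1 (1 - t) + Polygamma 1 t = pi ^ 2 / sin (pi * t) ^ 2" if t: "t \<in> {0<..<1}" for t :: real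
  proof -
    have "((\<lambda>t. Polygamma 0 (1 - t) - Polygamma 0 t) has_field_derivative
        - Polygamma 1 (1 - t) - Polygamma 1 t) (at t)"
      using nonpos[OF t] by (auto intro!: derivative_eq_intros)
    moreover have "((\<lambda>t. pi * cot (pi * t)) has_field_derivative - (pi ^ 2 / sin (pi * t) ^ 2)) (at t)"
    proof -
      have "((\<lambda>t. pi * (cos (pi * t) / sin (pi * t))) has_field_derivative
          pi * (((- sin (pi * t) * pi) * sin (pi * t) - cos (pi * t) * (cos (pi * t) * pi)) /
            (sin (pi * t) * sin (pi * t)))) (at t)"
        using sin[OF t] by (auto intro!: derivative_eq_intros simp: algebra_simps)
      also have "((- sin (pi * t) * pi) * sin (pi * t) - cos (pi * t) * (cos (pi * t) * pi)) =
          - pi * ((sin (pi * t)) ^ 2 + (cos (pi * t)) ^ 2)"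
        by algebra
      also have "\<dots> = - pi" by simp
      finally show ?thesis by (simp add: cot_def power2_eq_square)
    qed
    hence "((\<lambda>t. Polygamma 0 (1 - t) - Polygamma 0 t) has_field_derivative
        - (pi ^ 2 / sin (pi * t) ^ 2)) (at t)"
      by (rule has_field_derivative_transform_within_open[OF _ _ t]) (auto simp: Digamma_reflection)
    ultimately have "- Polygamma 1 (1 - t) - Polygamma 1 t = - (pi ^ 2 / sin (pi * t) ^ 2)"
      by (rule DERIV_unique)
    thus ?thesis by linarith
  qed
  have x: "x \<in> {0<..<1}" using assms by simp
  have "((\<lambda>t. Polygamma 1 (1 - t) + Polygamma 1 t) has_field_derivative
      - Polygamma 2 (1 - x) + Polygamma 2 x) (at x)"
    using nonpos[OF x] by (auto intro!: derivative_eq_intros simp: numeral_2_eq_2)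
  moreover have "((\<lambda>t. pi ^ 2 / sin (pi * t) ^ 2) has_field_derivative
      - (2 * pi ^ 3 * cos (pi * x) / sin (pi * x) ^ 3)) (at x)"
  proof (rule DERIV_cong)
    show "((\<lambda>t. pi ^ 2 / sin (pi * t) ^ 2) has_field_derivative
        (0 * sin (pi * x) ^ 2 - pi ^ 2 * (2 * (cos (pi * x) * pi) * sin (pi * x))) /
          (sin (pi * x) ^ 2 * sin (pi * x) ^ 2)) (at x)"
      using sin[OF x] by (auto intro!: derivative_eq_intros)
    show "(0 * sin (pi * x) ^ 2 - pi ^ 2 * (2 * (cos (pi * x) * pi) * sin (pi * x))) /
          (sin (pi * x) ^ 2 * sin (pi * x) ^ 2) = - (2 * pi ^ 3 * cos (pi * x) / sin (pi * x) ^ 3)"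
      using sin[OF x] by (simp add: power2_eq_square power3_eq_cube mult_ac)
  qed
  hence "((\<lambda>t. Polygamma 1 (1 - t) + Polygamma 1 t) has_field_derivative
      - (2 * pi ^ 3 * cos (pi * x) / sin (pi * x) ^ 3)) (at x)"
    by (rule has_field_derivative_transform_within_open[OF _ _ x]) (simp_all only: 1 open_greaterThanLessThan)
  ultimately have "- Polygamma 2 (1 - x) + Polygamma 2 x = - (2 * pi ^ 3 * cos (pi * x) / sin (pi * x) ^ 3)"
    by (rule DERIV_unique)
  thus ?thesis by linarith
qed

text \<open>
  Pairing consecutive terms gives \<open>(\<zeta>(3,1/4) - \<zeta>(3,3/4)) / 64\<close> with Hurwitz zeta values, which
  the twice differentiated reflection formula evaluates at \<open>x = 1/4\<close>.
\<close>
lemma dirichlet_beta_3: "dirichlet_beta 3 = pi ^ 3 / 32"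
proof -
  have P: "(\<lambda>k. 1 / (x + real k) ^ 3) sums (- Polygamma 2 x / 2)" if "x > 0" for x
    using Polygamma_LIMSEQ[of x 2] that by (simp add: inverse_eq_divide fact_2 del: power_Suc)
  have "(\<lambda>k. 1/64 * (1 / (1/4 + real k) ^ 3 - 1 / (3/4 + real k) ^ 3)) sums
      (1/64 * (- Polygamma 2 (1/4) / 2 - (- Polygamma 2 (3/4) / 2)))"
    by (intro sums_mult sums_diff P) auto
  also have "1/64 * (- Polygamma 2 (1/4) / 2 - (- Polygamma 2 (3/4) / 2)) =
      1/128 * (Polygamma 2 (1 - 1/4 :: real) - Polygamma 2 (1/4))"
    by simp
  also have "\<dots> = pi ^ 3 / 32"
  proof -
    have s: "sin (pi * (1/4)) = cos (pi * (1/4))" "cos (pi * (1/4)) = sqrt 2 / 2"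
      using sin_45 cos_45 by simp_all
    have "Polygamma 2 (1 - 1/4 :: real) - Polygamma 2 (1/4) =
        2 * pi ^ 3 * cos (pi * (1/4)) / sin (pi * (1/4)) ^ 3"
      by (rule Polygamma_2_reflection) auto
    also have "\<dots> = 2 * pi ^ 3 / cos (pi * (1/4)) ^ 2"
      unfolding s(1) using s(2) by (simp add: power2_eq_square power3_eq_cube)
    also have "\<dots> = 4 * pi ^ 3"
      unfolding s(2) by (simp add: power_divide)
    finally show ?thesis by simp
  qed
  finally have 1: "(\<lambda>k. 1/64 * (1 / (1/4 + real k) ^ 3 - 1 / (3/4 + real k) ^ 3)) sums (pi ^ 3 / 32)" .
  have "(\<lambda>k. \<Sum>i\<in>{k*2..<k*2+2}. (-1) ^ i / (2 * real i + 1) ^ 3) sums dirichlet_beta 3"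
    by (intro sums_group dirichlet_beta_sums) auto
  moreover have "(\<Sum>i\<in>{k*2..<k*2+2}. (-1) ^ i / (2 * real i + 1) ^ 3) =
      1/64 * (1 / (1/4 + real k) ^ 3 - 1 / (3/4 + real k) ^ 3)" for k
  proof -
    have "{k*2..<k*2+2} = {2*k, 2*k+1}" by auto
    moreover have "(2 * real (2*k) + 1) ^ 3 = 64 * (1/4 + real k) ^ 3"
      "(2 * real (2*k+1) + 1) ^ 3 = 64 * (3/4 + real k) ^ 3"
      by (simp_all add: power3_eq_cube algebra_simps)
    ultimately show ?thesis by (simp add: diff_divide_distrib[symmetric] add.commute)
  qed
  ultimately have "(\<lambda>k. 1/64 * (1 / (1/4 + real k) ^ 3 - 1 / (3/4 + real k) ^ 3)) sums dirichlet_beta 3"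
    by (simp only:)
  thus ?thesis using 1 by (rule sums_unique2)
qed

section \<open>Termwise and logarithmic differentiation\<close>

text \<open>
  Domination makes both series locally uniformly convergent, hence their sums holomorphic with
  termwise derivatives; the two sums are one function near \<open>0\<close>.
\<close>
lemma sums_derivative_transfer:
  fixes f l :: "nat \<Rightarrow> complex \<Rightarrow> complex"
  assumes r: "r > 0"
    and f: "\<And>n. f n holomorphic_on ball 0 r" "\<And>n x. x \<in> ball 0 r \<Longrightarrow> norm (f n x) \<le> h n" "summable h"
    and l: "\<And>n. l n holomorphic_on ball 0 r" "\<And>n x. x \<in> ball 0 r \<Longrightarrow> norm (l n x) \<le> h' n" "summable h'"
    and eq: "\<And>x S. x \<in> ball 0 r \<Longrightarrow> (\<lambda>n. l n x) sums S \<Longrightarrow> (\<lambda>n. f n x) sums S"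
    and f': "\<And>n. (f n has_field_derivative f' n) (at 0)"
    and l': "\<And>n. (l n has_field_derivative l' n) (at 0)"
    and D: "l' sums D"
  shows "f' sums D"
proof -
  have hd: "(g n has_field_derivative deriv (g n) x) (at x)"
    if "\<And>n. g n holomorphic_on ball 0 r" "x \<in> ball 0 r" for g :: "nat \<Rightarrow> complex \<Rightarrow> complex" and n x
    using that by (intro holomorphic_derivI[of _ "ball 0 r"]) auto
  have ev: "\<forall>\<^sub>F n in sequentially. \<forall>x\<in>ball 0 r. norm (g n x) \<le> k n"
    if "\<And>n x. x \<in> ball 0 r \<Longrightarrow> norm (g n x) \<le> k n" for g :: "nat \<Rightarrow> complex \<Rightarrow> complex" and k
    using that by (intro always_eventually) auto
  obtain F F' where F: "\<forall>x\<in>ball 0 r. (\<lambda>n. f n x) sums F x \<and> (\<lambda>n. deriv (f n) x) sums F' x \<and>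
      (F has_field_derivative F' x) (at x)"
    by (rule series_and_derivative_comparison[where S = "ball 0 r" and f = f and f' = "\<lambda>n. deriv (f n)"])
      (use f(3) hd[of f, OF f(1)] ev[of f h, OF f(2)] in \<open>simp_all del: mem_ball\<close>)
  obtain L L' where L: "\<forall>x\<in>ball 0 r. (\<lambda>n. l n x) sums L x \<and> (\<lambda>n. deriv (l n) x) sums L' x \<and>
      (L has_field_derivative L' x) (at x)"
    by (rule series_and_derivative_comparison[where S = "ball 0 r" and f = l and f' = "\<lambda>n. deriv (l n)"])
      (use l(3) hd[of l, OF l(1)] ev[of l h', OF l(2)] in \<open>simp_all del: mem_ball\<close>)
  have z: "0 \<in> ball 0 r" using r by simp
  have FL: "F x = L x" if "x \<in> ball 0 r" for x
    using F L eq[OF that] that sums_unique2 by blast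
  have "(L has_field_derivative L' 0) (at 0)" using L z by blast
  hence "(F has_field_derivative L' 0) (at 0)"
    by (rule has_field_derivative_transform_within_open[OF _ open_ball z]) (simp add: FL)
  moreover have "(F has_field_derivative F' 0) (at 0)" using F z by blast
  ultimately have "F' 0 = L' 0" by (rule DERIV_unique[symmetric])
  moreover have "f' sums F' 0"
  proof -
    have "(\<lambda>n. deriv (f n) 0) sums F' 0" using F z by blast
    thus ?thesis using DERIV_imp_deriv[OF f'] by simp
  qed
  moreover have "l' sums L' 0"
  proof -
    have "(\<lambda>n. deriv (l n) 0) sums L' 0" using L z by blast
    thus ?thesis using DERIV_imp_deriv[OF l'] by simp
  qed
  ultimately show ?thesis using D sums_unique2 by metis
qed

text \<open>
  The product form lets the rules for constants and products hold at zeros of \<open>f\<close> as well. Where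
  \<open>f\<close> does not vanish, \<open>p\<close> is the logarithmic derivative, which turns the factors of a Pochhammer
  symbol into the terms of a harmonic number.
\<close>
definition has_logderiv :: "(complex \<Rightarrow> complex) \<Rightarrow> complex \<Rightarrow> bool" where
  "has_logderiv f p \<longleftrightarrow> (f has_field_derivative f 0 * p) (at 0)"

lemma has_logderiv_const: "has_logderiv (\<lambda>x. c) 0"
  by (simp add: has_logderiv_def)

lemma has_logderiv_mult:
  assumes "has_logderiv f p" "has_logderiv g q"
  shows "has_logderiv (\<lambda>x. f x * g x) (p + q)"
  using assms unfolding has_logderiv_def by (auto intro!: derivative_eq_intros simp: algebra_simps)

lemma has_logderiv_divide:
  assumes "has_logderiv f p" "has_logderiv g q" "g 0 \<noteq> 0"
  shows "has_logderiv (\<lambda>x. f x / g x) (p - q)"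
  using assms unfolding has_logderiv_def
  by (auto intro!: derivative_eq_intros simp: field_simps)

lemma has_logderiv_affine:
  assumes "u \<noteq> 0"
  shows "has_logderiv (\<lambda>x. u + v * x) (v / u)"
  using assms unfolding has_logderiv_def by (auto intro!: derivative_eq_intros)

lemma has_logderiv_pochhammer:
  assumes "\<And>j. j < n \<Longrightarrow> u + of_nat j \<noteq> 0"
  shows "has_logderiv (\<lambda>x. pochhammer (u + v * x) n) (v * (\<Sum>j<n. 1 / (u + of_nat j)))"
  using assms
proof (induction n)
  case 0
  show ?case by (simp add: has_logderiv_const)
next
  case (Suc n)
  have "has_logderiv (\<lambda>x. (u + of_nat n) + v * x) (v / (u + of_nat n))"
    using Suc.prems by (intro has_logderiv_affine) auto
  from has_logderiv_mult[OF Suc.IH this] Suc.prems show ?case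
    by (simp add: pochhammer_Suc distrib_left algebra_simps)
qed

text \<open>
  The product of the two Pochhammer symbols at \<open>u \<plusminus> \<surd>w\<close>, written without the square root so that it
  is visibly polynomial in \<open>w\<close>.
\<close>
definition paired_pochhammer :: "complex \<Rightarrow> nat \<Rightarrow> complex \<Rightarrow> complex" where
  "paired_pochhammer u n w = (\<Prod>j<n. (u + of_nat j) ^ 2 - w)"

lemma paired_pochhammer_square:
  "paired_pochhammer u n (e ^ 2) = pochhammer (u + e) n * pochhammer (u - e) n"
proof (induction n)
  case (Suc n)
  have "paired_pochhammer u (Suc n) (e ^ 2) =
      paired_pochhammer u n (e ^ 2) * ((u + e + of_nat n) * (u - e + of_nat n))"
    by (simp add: paired_pochhammer_def power2_eq_square algebra_simps)
  thus ?case unfolding Suc by (simp add: pochhammer_Suc)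
qed (simp add: paired_pochhammer_def)

lemma has_logderiv_paired_pochhammer:
  assumes "\<And>j. j < n \<Longrightarrow> u + of_nat j \<noteq> 0"
  shows "has_logderiv (paired_pochhammer u n) (- (\<Sum>j<n. 1 / (u + of_nat j) ^ 2))"
  using assms
proof (induction n)
  case 0
  have "paired_pochhammer u 0 = (\<lambda>x. 1)" by (simp add: paired_pochhammer_def fun_eq_iff)
  thus ?case by (simp add: has_logderiv_const)
next
  case (Suc n)
  have "has_logderiv (\<lambda>x. (u + of_nat n) ^ 2 + (-1) * x) ((-1) / (u + of_nat n) ^ 2)"
    using Suc.prems[of n] by (intro has_logderiv_affine) auto
  from has_logderiv_mult[OF Suc.IH this] Suc.prems
  have "has_logderiv (\<lambda>x. paired_pochhammer u n x * ((u + of_nat n) ^ 2 + (-1) * x))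
     (- (\<Sum>j<n. 1 / (u + of_nat j) ^ 2) + (-1) / (u + of_nat n) ^ 2)"
    by simp
  moreover have "(\<lambda>x. paired_pochhammer u n x * ((u + of_nat n) ^ 2 + (-1) * x)) = paired_pochhammer u (Suc n)"
    by (simp add: paired_pochhammer_def fun_eq_iff)
  ultimately show ?case by simp
qed

section \<open>Acceleration of the sum over reciprocals of two linear factors\<close>

lemma pochhammer_neq_0:
  fixes u :: complex
  assumes "\<And>n::nat. u + of_nat n \<noteq> 0"
  shows "pochhammer u n \<noteq> 0"
  using assms by (auto simp: pochhammer_eq_0_iff eq_neg_iff_add_eq_0)

text \<open>
  The hypotheses on \<open>a\<close> make each denominator parameter exceed a numerator parameter by exactly one, so
  that all three quotients collapse.
\<close>
lemma wp_ratio_telescoped: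
  assumes u: "\<And>n::nat. u + of_nat n \<noteq> 0" and v: "\<And>n::nat. v + of_nat n \<noteq> 0"
    and w: "\<And>n::nat. w + of_nat n \<noteq> 0" and a: "a = u + v" "a = 2 * w"
  shows "wp_ratio a u v w n = u * v * w / ((u + of_nat n) * (v + of_nat n) * (w + of_nat n))"
proof -
  have eq: "1 + a - u = v + 1" "1 + a - v = u + 1" "1 + a - w = w + 1"
    using a(1) a(2) by (simp_all add: algebra_simps)
  have nz: "u \<noteq> 0" "v \<noteq> 0" "w \<noteq> 0" using u[of 0] v[of 0] w[of 0] by simp_all
  show ?thesis
    unfolding wp_ratio_def eq pochhammer_shift1[OF nz(1)] pochhammer_shift1[OF nz(2)]
      pochhammer_shift1[OF nz(3)]
    using pochhammer_neq_0[OF u] pochhammer_neq_0[OF v] pochhammer_neq_0[OF w] nz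
    by (simp add: mult_ac)
qed

lemma tendsto_reciprocal_shift: "(\<lambda>n. 1 / (z + of_nat n :: complex)) \<longlonglongrightarrow> 0"
  by (intro tendsto_divide_0[OF tendsto_const] tendsto_add_filterlim_at_infinity[OF tendsto_const]
      tendsto_of_nat)

text \<open>
  The hypothesis \<open>ratio\<close> lets \<open>u\<close>, \<open>v\<close>, \<open>w\<close> be any arrangement of \<open>b\<close>, \<open>c\<close>, \<open>d\<close>. The
  slow sum is symmetric in the three parameters, while its acceleration singles out \<open>b\<close>; different
  arrangements therefore give different fast series for the same value. Division by \<open>bcd\<close>
  removes a factor that would otherwise contribute to the derivatives.
\<close>
lemma alternating_reciprocal_accelerated:
  assumes near: "near_central a b c d"
    and u: "\<And>n::nat. u + of_nat n \<noteq> 0" and v: "\<And>n::nat. v + of_nat n \<noteq> 0"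
    and w: "\<And>n::nat. w + of_nat n \<noteq> 0" and a: "a = u + v" "a = 2 * w"
    and ratio: "\<And>n. wp_ratio a b c d n = wp_ratio a u v w n" and prod: "b * c * d = u * v * w"
    and S: "(\<lambda>n. 2 * (-1) ^ n / ((u + of_nat n) * (v + of_nat n))) sums S"
  shows "(\<lambda>k. accel_coeff a b c d k / (b * c * d) * accel_head (a + 2 * of_nat k) (b + of_nat k) c d) sums S"
proof -
  define s where "s = 1 + 2 * a - b - c - d"
  have nz: "b * c * d \<noteq> 0"
    unfolding prod using u[of 0] v[of 0] w[of 0] by simp
  have rat: "wp_ratio a b c d n = b * c * d / ((u + of_nat n) * (v + of_nat n) * (w + of_nat n))" for n
    unfolding ratio prod by (rule wp_ratio_telescoped[OF u v w a])
  have "(\<lambda>n. (b * c * d) * (1 + (s - w) * (1 / (w + of_nat n))) * (1 / (u + of_nat n)) * (1 / (v + of_nat n)))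
      \<longlonglongrightarrow> (b * c * d) * (1 + (s - w) * 0) * 0 * 0"
    by (intro tendsto_intros tendsto_reciprocal_shift)
  moreover have "(b * c * d) * (1 + (s - w) * (1 / (w + of_nat n))) * (1 / (u + of_nat n)) * (1 / (v + of_nat n)) =
      (s + of_nat n) * wp_ratio a b c d n" for n
  proof -
    have "1 + (s - w) * (1 / (w + of_nat n)) = (s + of_nat n) / (w + of_nat n)"
      using w[of n] by (simp add: field_simps)
    thus ?thesis by (simp add: rat mult_ac)
  qed
  ultimately have lim: "(\<lambda>n. (s + of_nat n) * wp_ratio a b c d n) \<longlonglongrightarrow> 0"
    by simp
  have "(\<lambda>n. (b * c * d) * (2 * (-1) ^ n / ((u + of_nat n) * (v + of_nat n)))) sums (b * c * d * S)"
    by (rule sums_mult[OF S])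
  moreover have "(b * c * d) * (2 * (-1) ^ n / ((u + of_nat n) * (v + of_nat n))) = wp_term a b c d n" for n
  proof -
    have "a + 2 * of_nat n = 2 * (w + of_nat n)" by (simp add: a(2))
    hence "wp_term a b c d n = (-1) ^ n * (2 * (w + of_nat n)) *
        (b * c * d / ((u + of_nat n) * (v + of_nat n) * (w + of_nat n)))"
      unfolding wp_term_def rat by simp
    also have "\<dots> = (b * c * d) * (2 * (-1) ^ n / ((u + of_nat n) * (v + of_nat n)))"
    proof -
      have "e * (2 * W) * (K / (U * V * W)) = K * (2 * e / (U * V))" if "W \<noteq> 0" for e K U V W :: complex
        using that by simp
      thus ?thesis using w[of n] by blast
    qed
    finally show ?thesis ..
  qed
  ultimately have "wp_term a b c d sums (b * c * d * S)" by simp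
  from sums_divide[OF wp_accelerated_sums[OF near lim[unfolded s_def] this], of "b * c * d"]
  show ?thesis using nz by simp
qed

lemma norm_accel_term_le:
  assumes near: "near_central a b c d"
  shows "norm (accel_coeff a b c d k / (b * c * d) * accel_head (a + 2 * of_nat k) (b + of_nat k) c d) \<le>
      60 * ((real k + 1) * (1/2) ^ k)"
proof -
  note bds = near_central_bounds(13-15)[OF near]
  have "(9/20) * (9/20) * (9/20) \<le> norm (b * c * d)"
    unfolding norm_mult using bds by (intro mult_mono) auto
  hence "norm (accel_coeff a b c d k / (b * c * d)) \<le> (1/2) ^ k / ((9/20) * (9/20) * (9/20))"
    unfolding norm_divide by (intro frac_le norm_accel_coeff_le[OF near]) auto
  also have "\<dots> \<le> 12 * (1/2) ^ k" by simp
  finally have "norm (accel_coeff a b c d k / (b * c * d) * accel_head (a + 2 * of_nat k) (b + of_nat k) c d)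
      \<le> 12 * (1/2) ^ k * (5 * (real k + 1))"
    unfolding norm_mult by (intro mult_mono norm_accel_head_le[OF near]) auto
  also have "12 * (1/2) ^ k * (5 * (real k + 1)) = 60 * ((real k + 1) * (1/2) ^ k)"
    by simp
  finally show ?thesis .
qed

lemma summable_accel_bound: "summable (\<lambda>k. 60 * ((real k + 1) * (1/2) ^ k))"
proof -
  have "(\<lambda>k. of_nat (Suc k) * (1/2) ^ k) sums (1 / (1 - 1/2 :: real) ^ 2)"
    by (rule geometric_deriv_sums) simp
  thus ?thesis
    by (intro summable_mult) (simp add: sums_iff add.commute)
qed

lemma half_plus_neq_0:
  fixes y :: complex
  assumes "norm y < 1/2"
  shows "1/2 + y + of_nat n \<noteq> 0"
proof
  assume "1/2 + y + of_nat n = 0"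
  hence "Re (1/2 + y + of_nat n) = 0" by simp
  hence "Re y \<le> - 1/2" by simp
  thus False using abs_Re_le_cmod[of y] assms by linarith
qed

lemma norm_alternating_term_le:
  fixes u v :: complex
  assumes "norm (u - 1/2) \<le> 1/20" "norm (v - 1/2) \<le> 1/20"
  shows "norm (2 * (-1) ^ n / ((u + of_nat n) * (v + of_nat n))) \<le> 10 * (1 / (real n + 1) ^ 2)"
proof -
  have *: "9/20 * (real n + 1) \<le> norm (z + of_nat n)" if "norm (z - 1/2) \<le> 1/20" for z :: complex
    using norm_near_real(2)[of "z + of_nat n" "real n + 1/2" "1/20"] that by simp
  have "norm (2 * (-1) ^ n / ((u + of_nat n) * (v + of_nat n))) =
      2 / (norm (u + of_nat n) * norm (v + of_nat n))"
    by (simp add: norm_divide norm_mult norm_power)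
  also have "\<dots> \<le> 2 / ((9/20 * (real n + 1)) * (9/20 * (real n + 1)))"
    using *[OF assms(1)] *[OF assms(2)]
    by (intro divide_left_mono mult_mono mult_pos_pos) (auto intro: less_le_trans[rotated])
  also have "\<dots> = (800/81) * (1 / (real n + 1) ^ 2)"
    by (simp add: power2_eq_square field_simps)
  also have "\<dots> \<le> 10 * (1 / (real n + 1) ^ 2)"
    by (intro mult_right_mono) auto
  finally show ?thesis .
qed

lemma summable_alternating_bound: "summable (\<lambda>n. 10 * (1 / (real n + 1) ^ 2))"
  using inverse_squares_sums by (intro summable_mult) (simp add: sums_iff add.commute)

lemma has_field_derivative_logderiv_mult:
  assumes "has_logderiv A L" "(H has_field_derivative H') (at 0)"
  shows "((\<lambda>x. A x * H x) has_field_derivative A 0 * (L * H 0 + H')) (at 0)"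
  using assms unfolding has_logderiv_def by (auto intro!: derivative_eq_intros simp: algebra_simps)

section \<open>Values at the centre and harmonic numbers\<close>

text \<open>
  The values at the centre of the coefficient (divided by \<open>bcd = 1/8\<close>) and of the head; both
  deformations share them.
\<close>
definition central_coeff :: "nat \<Rightarrow> real" where
  "central_coeff n = (-1) ^ n * fact n ^ 2 * fact (2 * n) /
     ((1/2 + real n) * pochhammer (1/2) (2 * n + 1) ^ 2)"

definition central_head :: "nat \<Rightarrow> real" where
  "central_head n = 3/2 + 3 * real n - (1 + real n) ^ 2 * (1 + 2 * real n) / (3/2 + 2 * real n) ^ 2"

definition half_harmonic :: "nat \<Rightarrow> nat \<Rightarrow> real" where
  "half_harmonic m n = (\<Sum>j<n. 1 / (1/2 + real j) ^ m)"

lemma harmonic_Suc: "harmonic m (Suc n) = harmonic m n + 1 / (real n + 1) ^ m"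
proof -
  have "{0<..Suc n} = insert (Suc n) {0<..n}" by auto
  thus ?thesis by (simp add: harmonic_def add.commute)
qed

lemma harmonic_eq_sum_lessThan: "harmonic m n = (\<Sum>j<n. 1 / (1 + real j) ^ m)"
proof (induction n)
  case 0
  show ?case by (simp add: harmonic_def)
qed (simp add: harmonic_Suc add.commute)

text \<open>
  Reciprocals of odd numbers are all reciprocals up to \<open>2n\<close> minus the even ones.
\<close>
lemma half_harmonic_eq: "half_harmonic m n = 2 ^ m * harmonic m (2 * n) - harmonic m n"
proof (induction n)
  case 0
  show ?case by (simp add: harmonic_def half_harmonic_def)
next
  case (Suc n)
  have 1: "1 / (1/2 + real n) ^ m = 2 ^ m * (1 / (real (2 * n) + 1) ^ m)"
  proof -
    have "real (2 * n) + 1 = 2 * (1/2 + real n)" by simp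
    thus ?thesis by (simp only: power_mult_distrib) simp
  qed
  have 2: "1 / (real n + 1) ^ m = 2 ^ m * (1 / (real (Suc (2 * n)) + 1) ^ m)"
  proof -
    have "real (Suc (2 * n)) + 1 = 2 * (real n + 1)" by simp
    thus ?thesis by (simp only: power_mult_distrib) simp
  qed
  have "half_harmonic m (Suc n) = half_harmonic m n + 1 / (1/2 + real n) ^ m"
    by (simp add: half_harmonic_def)
  moreover have "harmonic m (2 * Suc n) =
      harmonic m (2 * n) + 1 / (real (2 * n) + 1) ^ m + 1 / (real (Suc (2 * n)) + 1) ^ m"
    by (simp only: mult_Suc_right add_2_eq_Suc harmonic_Suc)
  ultimately show ?case
    using Suc 1 2 by (simp only: harmonic_Suc distrib_left)
qed

lemma sum_reciprocal_of_real:
  "(\<Sum>j<n. 1 / (1/2 + complex_of_nat j) ^ m) = of_real (half_harmonic m n)"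
  "(\<Sum>j<n. 1 / (1 + complex_of_nat j) ^ m) = of_real (harmonic m n)"
  by (simp_all add: half_harmonic_def harmonic_eq_sum_lessThan)

lemma pochhammer_one_half_complex: "pochhammer (1/2 :: complex) n = of_real (pochhammer (1/2) n)"
  using pochhammer_of_real[of "1/2 :: real" n, where 'a = complex] by simp

lemma pochhammer_split_first:
  fixes x :: complex
  assumes "x \<noteq> 0"
  shows "pochhammer (x + 1) n = pochhammer x (n + 1) / x"
  using assms by (simp add: pochhammer_rec)

section \<open>First-order deformations\<close>

lemma accel_coeff_first_family:
  assumes u: "\<And>n::nat. u + of_nat n \<noteq> 0" and v: "\<And>n::nat. v + of_nat n \<noteq> 0"
    and w: "\<And>n::nat. w + of_nat n \<noteq> 0" and a: "a = u + v" "a = 2 * w" and e: "v - w = e"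
  shows "accel_coeff a u v w n / (u * v * w) =
      (-1) ^ n * fact n * pochhammer (1 + e) n * pochhammer (1 - e) (2 * n) * pochhammer u n /
      (pochhammer v (n + 1) * pochhammer u (2 * n + 1) * pochhammer w (2 * n + 1))"
proof -
  have nz: "u \<noteq> 0" "v \<noteq> 0" "w \<noteq> 0" using u[of 0] v[of 0] w[of 0] by simp_all
  have eq: "1 + a - u - v = 1" "1 + a - u - w = 1 + e" "1 + a - v - w = 1 - e"
    "1 + a - u = v + 1" "1 + a - v = u + 1" "1 + a - w = w + 1"
    using a e by (simp_all add: algebra_simps)
  show ?thesis
    unfolding accel_coeff_def eq(1-3) unfolding eq(4-6) pochhammer_split_first[OF nz(1)]
      pochhammer_split_first[OF nz(2)] pochhammer_split_first[OF nz(3)]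
    using nz by (simp add: pochhammer_fact mult_ac)
qed

lemma accel_head_first_family:
  assumes a: "a = u + v" "a = 2 * w" and e: "v - w = e"
  shows "accel_head (a + 2 * of_nat n) (u + of_nat n) v w =
      1 + w + 3 * of_nat n - (1 + of_nat n) * (1 + e + of_nat n) * (1 - e + 2 * of_nat n) /
        ((u + 1 + 2 * of_nat n) * (w + 1 + 2 * of_nat n))"
proof -
  define m :: complex where "m = of_nat n"
  have "u = w - e" "v = w + e" using a e by (simp_all add: algebra_simps)
  hence eq: "1 + 2 * (a + 2 * m) - (u + m) - v - w = 1 + w + 3 * m"
    "1 + (a + 2 * m) - (u + m) - v = 1 + m" "1 + (a + 2 * m) - (u + m) - w = 1 + e + m"
    "1 + (a + 2 * m) - v - w = 1 - e + 2 * m" "1 + (a + 2 * m) - v = u + 1 + 2 * m"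
    "1 + (a + 2 * m) - w = w + 1 + 2 * m"
    using a by (simp_all add: algebra_simps)
  show ?thesis
    unfolding accel_head_def m_def[symmetric] eq(1-4) unfolding eq(5,6) ..
qed

lemma beta3_alternating:
  "(\<lambda>n. 2 * (-1) ^ n / (1/2 + complex_of_nat n) ^ 3) sums of_real (pi ^ 3 / 2)"
proof -
  have "(\<lambda>n. 16 * ((-1) ^ n / (2 * real n + 1) ^ 3)) sums (16 * dirichlet_beta 3)"
    by (intro sums_mult dirichlet_beta_sums) auto
  also have "(\<lambda>n. 16 * ((-1) ^ n / (2 * real n + 1) ^ 3)) = (\<lambda>n. 2 * (-1) ^ n / (1/2 + real n) ^ 3)"
  proof
    fix n :: nat
    have "(2 * real n + 1) ^ 3 = 8 * (1/2 + real n) ^ 3"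
      by (simp add: power3_eq_cube algebra_simps)
    thus "16 * ((-1) ^ n / (2 * real n + 1) ^ 3) = 2 * (-1) ^ n / (1/2 + real n) ^ 3" by simp
  qed
  finally have "(\<lambda>n. complex_of_real (2 * (-1) ^ n / (1/2 + real n) ^ 3)) sums of_real (16 * dirichlet_beta 3)"
    by (rule sums_of_real)
  thus ?thesis by (simp add: dirichlet_beta_3)
qed

lemma beta4_alternating:
  "(\<lambda>n. 2 * (-1) ^ n / (1/2 + complex_of_nat n) ^ 4) sums of_real (32 * dirichlet_beta 4)"
proof -
  have "(\<lambda>n. 32 * ((-1) ^ n / (2 * real n + 1) ^ 4)) sums (32 * dirichlet_beta 4)"
    by (intro sums_mult dirichlet_beta_sums) auto
  also have "(\<lambda>n. 32 * ((-1) ^ n / (2 * real n + 1) ^ 4)) = (\<lambda>n. 2 * (-1) ^ n / (1/2 + real n) ^ 4)"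
  proof
    fix n :: nat
    have "(2 * real n + 1) ^ 4 = (2 * (1/2 + real n)) ^ 4" by (simp add: algebra_simps)
    also have "\<dots> = 16 * (1/2 + real n) ^ 4" by (simp only: power_mult_distrib) simp
    finally show "32 * ((-1) ^ n / (2 * real n + 1) ^ 4) = 2 * (-1) ^ n / (1/2 + real n) ^ 4" by simp
  qed
  finally have "(\<lambda>n. complex_of_real (2 * (-1) ^ n / (1/2 + real n) ^ 4)) sums of_real (32 * dirichlet_beta 4)"
    by (rule sums_of_real)
  thus ?thesis by simp
qed

lemma half_of_nat_neq_0: "1/2 + complex_of_nat n \<noteq> 0"
  using half_plus_neq_0[of 0 n] by simp

lemma one_plus_of_nat_neq_0: "1 + complex_of_nat n \<noteq> 0"
  by (metis of_nat_Suc of_nat_neq_0)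

lemma pochhammer_one_half_neq_0: "pochhammer (1/2 :: complex) n \<noteq> 0"
  by (rule pochhammer_neq_0[OF half_of_nat_neq_0])

text \<open>
  Along \<open>b = 1/2 + p x\<close>, \<open>c = 1/2 + q x\<close>, \<open>d = 1/2 + r x\<close>, \<open>a = b + c\<close> the integer-based
  parameters become \<open>1\<close>, \<open>1 + e x\<close> and \<open>1 - e x\<close>. The summand is the derivative at \<open>x = 0\<close> of coefficient times
  head: the bracket multiplying \<open>central_head\<close> is the logarithmic derivative of the coefficient,
  the rest is the derivative of the head.
\<close>
lemma first_order_variation:
  fixes p q :: real
  assumes pq: "\<bar>p\<bar> \<le> 3" "\<bar>q\<bar> \<le> 3"
  defines "e \<equiv> (q - p) / 2" and "r \<equiv> (p + q) / 2"
  shows "(\<lambda>n. central_coeff n *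
      ((e * harmonic1 n - e * harmonic1 (2 * n) + p * half_harmonic 1 n - q * half_harmonic 1 (n + 1)
          - (p + r) * half_harmonic 1 (2 * n + 1)) * central_head n
        + (r - (1 + real n) ^ 2 * (1 + 2 * real n) / (3/2 + 2 * real n) ^ 2 *
            (e / (1 + real n) - e / (1 + 2 * real n) - (p + r) / (3/2 + 2 * real n)))))
    sums (- r * pi ^ 3)"
proof -
  define P Q R E where "P = complex_of_real p" and "Q = complex_of_real q"
    and "R = complex_of_real r" and "E = complex_of_real e"
  have R: "P + Q = 2 * R" and E: "Q - R = E"
    by (simp_all add: P_def Q_def R_def E_def r_def e_def field_simps)
  have nPQR: "norm P \<le> 3" "norm Q \<le> 3" "norm R \<le> 3"
    using pq abs_triangle_ineq[of p q] by (simp_all add: P_def Q_def R_def r_def del: of_real_divide of_real_add)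
  \<comment> \<open>With \<open>|p|, |q|, |r| \<le> 3\<close> this keeps \<open>|a - 1| = 2 |r x|\<close> below \<open>1/20\<close>.\<close>
  define rad :: real where "rad = 1 / 120"
  have small: "norm (P * x) \<le> 1/40" "norm (Q * x) \<le> 1/40" "norm (R * x) \<le> 1/40"
    if "x \<in> ball 0 rad" for x
    using that nPQR mult_mono[of "norm P" 3 "norm x" rad] mult_mono[of "norm Q" 3 "norm x" rad]
      mult_mono[of "norm R" 3 "norm x" rad] by (simp_all add: norm_mult rad_def)
  have nz: "1/2 + P * x + of_nat n \<noteq> 0" "1/2 + Q * x + of_nat n \<noteq> 0" "1/2 + R * x + of_nat n \<noteq> 0"
    if "x \<in> ball 0 rad" for x n
    using small[OF that] by (intro half_plus_neq_0; simp)+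
  have near: "near_central (1 + 2 * R * x) (1/2 + P * x) (1/2 + Q * x) (1/2 + R * x)"
    if "x \<in> ball 0 rad" for x
    using small[OF that] by (simp add: near_central_def norm_mult)
  have a: "1 + 2 * R * x = (1/2 + P * x) + (1/2 + Q * x)" "1 + 2 * R * x = 2 * (1/2 + R * x)" for x
    using arg_cong[OF R, of "\<lambda>y. y * x"] by (simp_all add: algebra_simps)
  have e: "(1/2 + Q * x) - (1/2 + R * x) = E * x" for x
    using E by (simp add: algebra_simps)

  define A where "A n x = (-1) ^ n * fact n * pochhammer (1 + E * x) n * pochhammer (1 + (- E) * x) (2 * n) *
      pochhammer (1/2 + P * x) n /
      (pochhammer (1/2 + Q * x) (n + 1) * pochhammer (1/2 + P * x) (2 * n + 1) *
        pochhammer (1/2 + R * x) (2 * n + 1))" for n x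
  define H where "H n x = 1 + (1/2 + R * x) + 3 * of_nat n -
      (1 + of_nat n) * (1 + E * x + of_nat n) * (1 - E * x + 2 * of_nat n) /
        ((1/2 + P * x + 1 + 2 * of_nat n) * (1/2 + R * x + 1 + 2 * of_nat n))" for n x
  define l where "l n x = 2 * (-1) ^ n / ((1/2 + P * x + of_nat n) * (1/2 + Q * x + of_nat n))" for n x
  have AH: "accel_coeff (1 + 2 * R * x) (1/2 + P * x) (1/2 + Q * x) (1/2 + R * x) n /
        ((1/2 + P * x) * (1/2 + Q * x) * (1/2 + R * x)) *
      accel_head (1 + 2 * R * x + 2 * of_nat n) (1/2 + P * x + of_nat n) (1/2 + Q * x) (1/2 + R * x) =
      A n x * H n x" if "x \<in> ball 0 rad" for n x
    unfolding accel_coeff_first_family[OF nz[OF that] a e] accel_head_first_family[OF a e]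
    by (simp add: A_def H_def)
  have nz': "1/2 + P * x + 1 + 2 * of_nat n \<noteq> 0" "1/2 + R * x + 1 + 2 * of_nat n \<noteq> 0"
    if "x \<in> ball 0 rad" for x n
    using nz(1,3)[OF that, of "2 * n + 1"] by (simp_all add: add_ac)
  have poch: "pochhammer (1/2 + P * x) m \<noteq> 0" "pochhammer (1/2 + Q * x) m \<noteq> 0"
    "pochhammer (1/2 + R * x) m \<noteq> 0" if "x \<in> ball 0 rad" for x m
    by (rule pochhammer_neq_0, rule nz[OF that])+
  have holA: "(\<lambda>x. A n x * H n x) holomorphic_on ball 0 rad" for n
    unfolding A_def H_def using nz' poch by (intro holomorphic_intros) (auto simp del: mem_ball)
  have holl: "l n holomorphic_on ball 0 rad" for n
    unfolding l_def using nz by (intro holomorphic_intros) (auto simp del: mem_ball)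
  define L where "L n = E * (\<Sum>j<n. 1 / (1 + of_nat j)) - E * (\<Sum>j<2*n. 1 / (1 + of_nat j))
      + P * (\<Sum>j<n. 1 / (1/2 + of_nat j)) - (Q * (\<Sum>j<n+1. 1 / (1/2 + of_nat j))
      + P * (\<Sum>j<2*n+1. 1 / (1/2 + of_nat j)) + R * (\<Sum>j<2*n+1. 1 / (1/2 + of_nat j)))" for n
  have LA: "has_logderiv (A n) (L n)" for n
  proof -
    have "has_logderiv (A n) (0 + E * (\<Sum>j<n. 1 / (1 + of_nat j)) + (- E) * (\<Sum>j<2*n. 1 / (1 + of_nat j))
      + P * (\<Sum>j<n. 1 / (1/2 + of_nat j)) - (Q * (\<Sum>j<n+1. 1 / (1/2 + of_nat j))
      + P * (\<Sum>j<2*n+1. 1 / (1/2 + of_nat j)) + R * (\<Sum>j<2*n+1. 1 / (1/2 + of_nat j))))"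
      unfolding A_def
      by (intro has_logderiv_divide has_logderiv_mult has_logderiv_const has_logderiv_pochhammer)
        (use half_of_nat_neq_0 one_plus_of_nat_neq_0 pochhammer_one_half_neq_0 in \<open>auto simp: add_eq_0_iff simp del: of_nat_add\<close>)
    thus ?thesis by (simp add: L_def)
  qed
  define M0 where "M0 n = (1 + complex_of_nat n) ^ 2 * (1 + 2 * of_nat n) / (3/2 + 2 * of_nat n) ^ 2" for n
  define H' where "H' n = R - M0 n * (E / (1 + of_nat n) - E / (1 + 2 * of_nat n) - (P + R) / (3/2 + 2 * of_nat n))" for n
  have nzc: "(3/2 + 2 * of_nat n :: complex) \<noteq> 0" "(1 + of_nat n :: complex) \<noteq> 0" "(1 + 2 * of_nat n :: complex) \<noteq> 0" for n
    using half_of_nat_neq_0[of "2 * n + 1"] of_nat_neq_0[of n, where 'a = complex]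
      of_nat_neq_0[of "2 * n", where 'a = complex] by (simp_all add: add_ac)
  have dH: "(H n has_field_derivative H' n) (at 0)" for n
  proof -
    have 1: "has_logderiv (\<lambda>x. (1 + of_nat n) * ((1 + of_nat n) + E * x) * ((1 + 2 * of_nat n) + (- E) * x) /
        (((3/2 + 2 * of_nat n) + P * x) * ((3/2 + 2 * of_nat n) + R * x)))
        (0 + E / (1 + of_nat n) + (- E) / (1 + 2 * of_nat n) -
          (P / (3/2 + 2 * of_nat n) + R / (3/2 + 2 * of_nat n)))"
      by (intro has_logderiv_divide has_logderiv_mult has_logderiv_const has_logderiv_affine)
        (use nzc in auto)
    have 2: "((\<lambda>x. (1 + of_nat n) * ((1 + of_nat n) + E * x) * ((1 + 2 * of_nat n) + (- E) * x) /
        (((3/2 + 2 * of_nat n) + P * x) * ((3/2 + 2 * of_nat n) + R * x))) has_field_derivative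
        M0 n * (E / (1 + of_nat n) - E / (1 + 2 * of_nat n) - (P + R) / (3/2 + 2 * of_nat n))) (at 0)"
      using 1 unfolding has_logderiv_def M0_def by (simp add: add_divide_distrib power2_eq_square)
    have 3: "((\<lambda>x. 1 + (1/2 + R * x) + 3 * of_nat n) has_field_derivative R) (at 0)"
      by (auto intro!: derivative_eq_intros)
    show ?thesis
      using DERIV_diff[OF 3 2] unfolding H_def H'_def by (simp add: algebra_simps)
  qed
  have dl: "(l n has_field_derivative (- R) * (2 * (2 * (-1) ^ n / (1/2 + of_nat n) ^ 3))) (at 0)" for n
  proof -
    have "has_logderiv (\<lambda>x. 2 * (-1) ^ n / (((1/2 + of_nat n) + P * x) * ((1/2 + of_nat n) + Q * x)))
        (0 - (P / (1/2 + of_nat n) + Q / (1/2 + of_nat n)))"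
      by (intro has_logderiv_divide has_logderiv_mult has_logderiv_const has_logderiv_affine)
        (use half_of_nat_neq_0[of n] in auto)
    moreover have "(\<lambda>x. 2 * (-1) ^ n / (((1/2 + of_nat n) + P * x) * ((1/2 + of_nat n) + Q * x))) = l n"
      by (simp add: l_def fun_eq_iff add_ac)
    moreover have "0 - (P / (1/2 + of_nat n) + Q / (1/2 + of_nat n)) = - (2 * R) / (1/2 + of_nat n)"
      using R by (simp add: add_divide_distrib[symmetric])
    ultimately have "(l n has_field_derivative l n 0 * (- (2 * R) / (1/2 + of_nat n))) (at 0)"
      by (simp add: has_logderiv_def)
    moreover have "l n 0 * (- (2 * R) / (1/2 + of_nat n)) = (- R) * (2 * (2 * (-1) ^ n / (1/2 + of_nat n) ^ 3))"
      by (simp add: l_def power3_eq_cube)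
    ultimately show ?thesis by simp
  qed
  have "(\<lambda>n. A n 0 * (L n * H n 0 + H' n)) sums ((- R) * (2 * of_real (pi ^ 3 / 2)))"
  proof (rule sums_derivative_transfer[where f = "\<lambda>n x. A n x * H n x" and l = l and r = rad])
    show "rad > 0" by (simp add: rad_def)
    show "norm (A n x * H n x) \<le> 60 * ((real n + 1) * (1/2) ^ n)" if "x \<in> ball 0 rad" for n x
      using norm_accel_term_le[OF near[OF that], of n] unfolding AH[OF that] .
    show "norm (l n x) \<le> 10 * (1 / (real n + 1) ^ 2)" if "x \<in> ball 0 rad" for n x
      unfolding l_def using small[OF that] by (intro norm_alternating_term_le) auto
    show "(\<lambda>n. A n x * H n x) sums S" if x: "x \<in> ball 0 rad" and S: "(\<lambda>n. l n x) sums S" for x S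
      using alternating_reciprocal_accelerated[OF near[OF x] nz[OF x] a refl refl S[unfolded l_def]]
      unfolding AH[OF x] .
    show "(\<lambda>n. (- R) * (2 * (2 * (-1) ^ n / (1/2 + of_nat n) ^ 3))) sums ((- R) * (2 * of_real (pi ^ 3 / 2)))"
      by (intro sums_mult beta3_alternating)
    show "((\<lambda>x. A n x * H n x) has_field_derivative A n 0 * (L n * H n 0 + H' n)) (at 0)" for n
      by (rule has_field_derivative_logderiv_mult[OF LA dH])
  qed (rule holA holl dl summable_accel_bound summable_alternating_bound)+
  also have "(\<lambda>n. A n 0 * (L n * H n 0 + H' n)) = (\<lambda>n. complex_of_real (central_coeff n *
      ((e * harmonic1 n - e * harmonic1 (2 * n) + p * half_harmonic 1 n - q * half_harmonic 1 (n + 1)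
          - (p + r) * half_harmonic 1 (2 * n + 1)) * central_head n
        + (r - (1 + real n) ^ 2 * (1 + 2 * real n) / (3/2 + 2 * real n) ^ 2 *
            (e / (1 + real n) - e / (1 + 2 * real n) - (p + r) / (3/2 + 2 * real n))))))"
  proof
    fix n :: nat
    have 1: "A n 0 = of_real (central_coeff n)"
    proof -
      have "pochhammer (1/2 :: complex) (n + 1) = pochhammer (1/2) n * (1/2 + of_nat n)"
        by (simp add: pochhammer_Suc)
      hence "A n 0 = (-1) ^ n * fact n ^ 2 * fact (2 * n) / ((1/2 + of_nat n) * pochhammer (1/2) (2 * n + 1) ^ 2)"
        unfolding A_def using pochhammer_one_half_neq_0[of n]
        by (simp only: mult_zero_right add_0_right pochhammer_fact[symmetric])
          (simp add: power2_eq_square mult_ac)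
      thus ?thesis by (simp add: central_coeff_def pochhammer_one_half_complex)
    qed
    have 2: "H n 0 = of_real (central_head n)"
      by (simp add: H_def central_head_def power2_eq_square algebra_simps)
    have 3: "L n = of_real (e * harmonic1 n - e * harmonic1 (2 * n) + p * half_harmonic 1 n - q * half_harmonic 1 (n + 1)
          - (p + r) * half_harmonic 1 (2 * n + 1))"
      unfolding L_def sum_reciprocal_of_real[where m = 1, simplified power_one_right]
      by (simp add: P_def Q_def R_def E_def algebra_simps)
    have 4: "H' n = of_real (r - (1 + real n) ^ 2 * (1 + 2 * real n) / (3/2 + 2 * real n) ^ 2 *
            (e / (1 + real n) - e / (1 + 2 * real n) - (p + r) / (3/2 + 2 * real n)))"
      by (simp add: H'_def M0_def P_def R_def E_def)
    show "A n 0 * (L n * H n 0 + H' n) = complex_of_real (central_coeff n *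
      ((e * harmonic1 n - e * harmonic1 (2 * n) + p * half_harmonic 1 n - q * half_harmonic 1 (n + 1)
          - (p + r) * half_harmonic 1 (2 * n + 1)) * central_head n
        + (r - (1 + real n) ^ 2 * (1 + 2 * real n) / (3/2 + 2 * real n) ^ 2 *
            (e / (1 + real n) - e / (1 + 2 * real n) - (p + r) / (3/2 + 2 * real n)))))"
      unfolding 1 2 3 4 by (simp only: of_real_mult of_real_add)
  qed
  also have "(- R) * (2 * of_real (pi ^ 3 / 2)) = of_real (- r * pi ^ 3)"
    by (simp add: R_def)
  finally show ?thesis
    by (simp only: sums_of_real_iff)
qed

section \<open>A deformation with two opposite square roots\<close>

lemma has_field_derivative_reciprocal_square_diff:
  fixes z :: complex
  assumes "z \<noteq> 0"
  shows "((\<lambda>w. c / (z ^ 2 - w)) has_field_derivative c / z ^ 4) (at 0)"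
  using assms by (auto intro!: derivative_eq_intros simp: power2_eq_square power4_eq_xxxx)

lemma has_field_derivative_moebius:
  fixes z :: complex
  assumes "z \<noteq> 0"
  shows "((\<lambda>w. c - v * ((x - w) / (z ^ 2 - w))) has_field_derivative v * (1 / z ^ 2 - x / z ^ 4)) (at 0)"
proof (rule DERIV_cong)
  show "((\<lambda>w. c - v * ((x - w) / (z ^ 2 - w))) has_field_derivative
      - (v * ((- (z ^ 2) + x) / (z ^ 2 * z ^ 2)))) (at 0)"
    using assms by (auto intro!: derivative_eq_intros simp: right_diff_distrib)
  show "- (v * ((- (z ^ 2) + x) / (z ^ 2 * z ^ 2))) = v * (1 / z ^ 2 - x / z ^ 4)"
    using assms by (simp add: add_divide_distrib diff_divide_distrib right_diff_distrib power4_eq_xxxx power2_eq_square mult.assoc)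
qed

text \<open>
  Now the parameter that the acceleration singles out stays at \<open>1/2\<close> and the other two move
  symmetrically, so the result is even in \<open>e\<close>.
\<close>
lemma accel_coeff_second_family:
  assumes e: "norm e < 1/2"
  shows "accel_coeff 1 (1/2) (1/2 + e) (1/2 - e) n / ((1/2) * (1/2 + e) * (1/2 - e)) =
      (-1) ^ n * fact (2 * n) * paired_pochhammer 1 n (e ^ 2) /
      ((1/2 + of_nat n) * paired_pochhammer (1/2) (2 * n + 1) (e ^ 2))"
proof -
  have nz: "1/2 + e \<noteq> 0" "1/2 - e \<noteq> 0"
    using half_plus_neq_0[of e 0] half_plus_neq_0[of "- e" 0] e by simp_all
  have eq: "1 + 1 - 1/2 - (1/2 + e) = 1 - e" "1 + 1 - 1/2 - (1/2 - e) = 1 + e"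
    "1 + 1 - (1/2 + e) - (1/2 - e) = 1" "1 + 1 - (1/2 + e) = (1/2 - e) + 1"
    "1 + 1 - (1/2 - e) = (1/2 + e) + 1" "1 + 1 - 1/2 = 1/2 + (1 :: complex)"
    by (simp_all add: field_simps)
  have half: "(1/2 :: complex) \<noteq> 0" by simp
  show ?thesis
    unfolding accel_coeff_def eq(1-3) unfolding eq(4-6) pochhammer_split_first[OF nz(1)]
      pochhammer_split_first[OF nz(2)] pochhammer_shift1[OF half] paired_pochhammer_square
    using nz pochhammer_one_half_neq_0[of n] by (simp add: pochhammer_fact mult_ac)
qed

lemma accel_head_second_family:
  "accel_head (1 + 2 * of_nat n) (1/2 + of_nat n) (1/2 + e) (1/2 - e) =
     3/2 + 3 * of_nat n - (1 + 2 * of_nat n) * (((1 + of_nat n) ^ 2 - e ^ 2) / ((3/2 + 2 * of_nat n) ^ 2 - e ^ 2))"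
proof -
  define m :: complex where "m = of_nat n"
  have eq: "1 + 2 * (1 + 2 * m) - (1/2 + m) - (1/2 + e) - (1/2 - e) = 3/2 + 3 * m"
    "1 + (1 + 2 * m) - (1/2 + m) - (1/2 + e) = 1 + m - e"
    "1 + (1 + 2 * m) - (1/2 + m) - (1/2 - e) = 1 + m + e"
    "1 + (1 + 2 * m) - (1/2 + e) - (1/2 - e) = 1 + 2 * m"
    "1 + (1 + 2 * m) - (1/2 + e) = 3/2 + 2 * m - e" "1 + (1 + 2 * m) - (1/2 - e) = 3/2 + 2 * m + e"
    by (simp_all add: field_simps)
  have sq: "(x - e) * (x + e) = x ^ 2 - e ^ 2" for x
    by (simp add: power2_eq_square algebra_simps)
  show ?thesis
    unfolding accel_head_def m_def[symmetric] eq(1-4) unfolding eq(5,6) sq by (simp add: mult.commute)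
qed

text \<open>
  The bracket multiplying \<open>central_head\<close> is again the logarithmic derivative of the coefficient, now
  with respect to \<open>w = e^2\<close>; a first derivative in \<open>w\<close> replaces a second derivative in \<open>e\<close>.
\<close>
lemma second_order_variation:
  shows "(\<lambda>n. central_coeff n *
      ((half_harmonic 2 (2 * n + 1) - harmonic 2 n) * central_head n
        + (1 + 2 * real n) * (1 / (3/2 + 2 * real n) ^ 2 - (1 + real n) ^ 2 / (3/2 + 2 * real n) ^ 4)))
    sums (32 * dirichlet_beta 4)"
proof -
  \<comment> \<open>The square of the radius \<open>1/20\<close> allowed for \<open>c\<close> and \<open>d\<close>.\<close>
  define rad :: real where "rad = 1 / 400"
  have root: "norm (csqrt w) \<le> 1/20" if "w \<in> ball 0 rad" for w
  proof -
    have "norm (csqrt w) = sqrt (norm w)" by (simp add: norm_csqrt)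
    also have "\<dots> \<le> sqrt ((1/20) ^ 2)"
      using that by (intro real_sqrt_le_mono) (simp add: rad_def power2_eq_square)
    finally show ?thesis by simp
  qed
  have near: "near_central 1 (1/2) (1/2 + csqrt w) (1/2 - csqrt w)" if "w \<in> ball 0 rad" for w
    using root[OF that] by (simp add: near_central_def)
  have nz: "1/2 + csqrt w + of_nat n \<noteq> 0" "1/2 - csqrt w + of_nat n \<noteq> 0" if "w \<in> ball 0 rad" for w n
    using half_plus_neq_0[of "csqrt w" n] half_plus_neq_0[of "- csqrt w" n] root[OF that] by simp_all
  have sq: "(z + csqrt w) * (z - csqrt w) = z ^ 2 - w" for z w
    using power2_csqrt[of w] by (simp add: power2_eq_square algebra_simps)
  have nz2: "(1/2 + of_nat n) ^ 2 - w \<noteq> 0" if "w \<in> ball 0 rad" for w :: complex and n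
  proof -
    have "1/2 + of_nat n + csqrt w \<noteq> 0" "1/2 + of_nat n - csqrt w \<noteq> 0"
      using nz[OF that, of n] by (simp_all add: algebra_simps)
    thus ?thesis unfolding sq[symmetric] by simp
  qed
  have nz3: "(3/2 + 2 * of_nat n) ^ 2 - w \<noteq> 0" if "w \<in> ball 0 rad" for w :: complex and n
    using nz2[OF that, of "2 * n + 1"] by (simp add: add_ac)
  define A where "A n w = (-1) ^ n * fact (2 * n) * paired_pochhammer 1 n w /
      ((1/2 + of_nat n) * paired_pochhammer (1/2) (2 * n + 1) w)" for n w
  define H where "H n w = 3/2 + 3 * of_nat n -
      (1 + 2 * of_nat n) * (((1 + of_nat n) ^ 2 - w) / ((3/2 + 2 * of_nat n) ^ 2 - w))" for n and w :: complex
  define l where "l n w = 2 * (-1) ^ n / ((1/2 + of_nat n) ^ 2 - w)" for n and w :: complex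
  have AH: "accel_coeff 1 (1/2) (1/2 + csqrt w) (1/2 - csqrt w) n /
        ((1/2) * (1/2 + csqrt w) * (1/2 - csqrt w)) *
      accel_head (1 + 2 * of_nat n) (1/2 + of_nat n) (1/2 + csqrt w) (1/2 - csqrt w) =
      A n w * H n w" if "w \<in> ball 0 rad" for n w
  proof -
    have "norm (csqrt w) < 1/2" using root[OF that] by simp
    from accel_coeff_second_family[OF this] show ?thesis
      unfolding accel_head_second_family by (simp add: A_def H_def)
  qed
  have l: "l n w = 2 * (-1) ^ n / ((1/2 + csqrt w + of_nat n) * (1/2 - csqrt w + of_nat n))" for n w
    unfolding l_def sq[symmetric] by (simp add: algebra_simps)
  have pp: "paired_pochhammer (1/2) m w \<noteq> 0" if "w \<in> ball 0 rad" for w m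
    using nz2[OF that] by (simp add: paired_pochhammer_def)
  have pp0: "paired_pochhammer (1/2) m 0 \<noteq> 0" for m
    using half_of_nat_neq_0 by (simp add: paired_pochhammer_def)
  have holpp: "paired_pochhammer u m holomorphic_on S" for u m S
    unfolding paired_pochhammer_def by (intro holomorphic_intros)
  have holA: "(\<lambda>x. A n x * H n x) holomorphic_on ball 0 rad" for n
    unfolding A_def H_def using nz3 pp half_of_nat_neq_0
    by (intro holomorphic_intros holpp) (auto simp del: mem_ball)
  have holl: "l n holomorphic_on ball 0 rad" for n
    unfolding l_def using nz2 by (intro holomorphic_intros) (auto simp del: mem_ball)
  define L where "L n = - (\<Sum>j<n. 1 / (1 + complex_of_nat j) ^ 2)
      + (\<Sum>j<2*n+1. 1 / (1/2 + complex_of_nat j) ^ 2)" for n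
  have LA: "has_logderiv (A n) (L n)" for n
  proof -
    have "has_logderiv (A n) (0 + - (\<Sum>j<n. 1 / (1 + complex_of_nat j) ^ 2)
      - (0 + - (\<Sum>j<2*n+1. 1 / (1/2 + complex_of_nat j) ^ 2)))"
      unfolding A_def
      by (intro has_logderiv_divide has_logderiv_mult has_logderiv_const has_logderiv_paired_pochhammer)
        (use half_of_nat_neq_0 one_plus_of_nat_neq_0 pp0 in \<open>auto simp: add_eq_0_iff simp del: of_nat_add\<close>)
    thus ?thesis unfolding L_def by (simp only: add_0_left diff_minus_eq_add)
  qed
  have nzc: "(3/2 + 2 * of_nat n :: complex) \<noteq> 0" for n
    using half_of_nat_neq_0[of "2 * n + 1"] by (simp add: add_ac)
  define H' where "H' n = (1 + 2 * of_nat n) *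
      (1 / (3/2 + 2 * of_nat n) ^ 2 - (1 + of_nat n) ^ 2 / (3/2 + 2 * of_nat n :: complex) ^ 4)" for n
  have dH: "(H n has_field_derivative H' n) (at 0)" for n
    unfolding H_def H'_def by (rule has_field_derivative_moebius[OF nzc])
  have dl: "(l n has_field_derivative 2 * (-1) ^ n / (1/2 + of_nat n) ^ 4) (at 0)" for n
    unfolding l_def by (rule has_field_derivative_reciprocal_square_diff[OF half_of_nat_neq_0])
  have "(\<lambda>n. A n 0 * (L n * H n 0 + H' n)) sums of_real (32 * dirichlet_beta 4)"
  proof (rule sums_derivative_transfer[where f = "\<lambda>n x. A n x * H n x" and l = l and r = rad])
    show "rad > 0" by (simp add: rad_def)
    show "norm (A n x * H n x) \<le> 60 * ((real n + 1) * (1/2) ^ n)" if "x \<in> ball 0 rad" for n x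
      using norm_accel_term_le[OF near[OF that], of n] unfolding AH[OF that] .
    show "norm (l n x) \<le> 10 * (1 / (real n + 1) ^ 2)" if "x \<in> ball 0 rad" for n x
      unfolding l using root[OF that] by (intro norm_alternating_term_le) auto
    show "(\<lambda>n. A n x * H n x) sums S" if x: "x \<in> ball 0 rad" and S: "(\<lambda>n. l n x) sums S" for x S
    proof -
      have ratio: "wp_ratio 1 (1/2) (1/2 + csqrt x) (1/2 - csqrt x) n =
          wp_ratio 1 (1/2 + csqrt x) (1/2 - csqrt x) (1/2) n" for n
        by (simp add: wp_ratio_def mult_ac)
      have "(\<lambda>n. accel_coeff 1 (1/2) (1/2 + csqrt x) (1/2 - csqrt x) n /
          ((1/2) * (1/2 + csqrt x) * (1/2 - csqrt x)) *
        accel_head (1 + 2 * of_nat n) (1/2 + of_nat n) (1/2 + csqrt x) (1/2 - csqrt x)) sums S"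
        by (rule alternating_reciprocal_accelerated[OF near[OF x] nz[OF x] half_of_nat_neq_0 _ _ ratio _ S[unfolded l]])
          simp_all
      thus ?thesis unfolding AH[OF x] .
    qed
    show "((\<lambda>x. A n x * H n x) has_field_derivative A n 0 * (L n * H n 0 + H' n)) (at 0)" for n
      by (rule has_field_derivative_logderiv_mult[OF LA dH])
  qed (rule holA holl dl beta4_alternating summable_accel_bound summable_alternating_bound)+
  also have "(\<lambda>n. A n 0 * (L n * H n 0 + H' n)) = (\<lambda>n. complex_of_real (central_coeff n *
      ((half_harmonic 2 (2 * n + 1) - harmonic 2 n) * central_head n
        + (1 + 2 * real n) * (1 / (3/2 + 2 * real n) ^ 2 - (1 + real n) ^ 2 / (3/2 + 2 * real n) ^ 4))))"
  proof
    fix n :: nat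
    have 1: "A n 0 = of_real (central_coeff n)"
      using paired_pochhammer_square[of 1 n 0] paired_pochhammer_square[of "1/2" "2 * n + 1" 0]
      by (simp add: A_def central_coeff_def pochhammer_one_half_complex pochhammer_fact[symmetric]
          power2_eq_square mult_ac)
    have 2: "H n 0 = of_real (central_head n)"
      by (simp add: H_def central_head_def mult_ac)
    have 3: "L n = of_real (half_harmonic 2 (2 * n + 1) - harmonic 2 n)"
      unfolding L_def sum_reciprocal_of_real by simp
    have 4: "H' n = of_real ((1 + 2 * real n) *
        (1 / (3/2 + 2 * real n) ^ 2 - (1 + real n) ^ 2 / (3/2 + 2 * real n) ^ 4))"
      by (simp add: H'_def)
    show "A n 0 * (L n * H n 0 + H' n) = complex_of_real (central_coeff n *
      ((half_harmonic 2 (2 * n + 1) - harmonic 2 n) * central_head n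
        + (1 + 2 * real n) * (1 / (3/2 + 2 * real n) ^ 2 - (1 + real n) ^ 2 / (3/2 + 2 * real n) ^ 4)))"
      unfolding 1 2 3 4 by (simp only: of_real_mult of_real_add)
  qed
  finally show ?thesis
    by (simp only: sums_of_real_iff)
qed

section \<open>Binomial form of the terms\<close>

definition common_factor :: "nat \<Rightarrow> real" where
  "common_factor k = (-256) ^ k /
     (real k ^ 3 * (2 * real k - 1) * real ((2 * k) choose k) * real ((4 * k) choose (2 * k)) ^ 2)"

lemma pochhammer_one_half_eq:
  "pochhammer (1/2 :: real) n = fact (2 * n) / (4 ^ n * fact n)"
  using fact_double[of n, where 'a = real] by (simp add: power_mult)

text \<open>
  With \<open>k = n + 1\<close> the half-integer symbol is completed to \<open>(1/2)_{2k} = (4k)! / (16^k (2k)!)\<close>, and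
  \<open>C(2k,k) C(4k,2k)^2 = (4k)!^2 / (k!^2 (2k)!^3)\<close>.
\<close>
lemma central_coeff_eq:
  "central_coeff n = - common_factor (n + 1) * (4 * real n + 3) ^ 2 / (4 * (2 * real n + 1))"
proof -
  define k where "k = n + 1"
  \<comment> \<open>All factorials and powers are reduced to these three and \<open>W\<close>; the rest is rational in \<open>n\<close>.\<close>
  define F G J :: real where "F = fact k" and "G = fact (2 * k)" and "J = fact (4 * k)"
  have pos: "F > 0" "G > 0" "J > 0" by (simp_all add: F_def G_def J_def)
  have c1: "real ((2 * k) choose k) = G / F ^ 2"
    using binomial_fact[of k "2 * k", where 'a = real]
    by (simp add: F_def G_def power2_eq_square mult_2)
  have c2: "real ((4 * k) choose (2 * k)) = J / G ^ 2"
    using binomial_fact[of "2 * k" "4 * k", where 'a = real]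
    by (simp add: J_def G_def power2_eq_square)
  have f1: "fact n = F / (real n + 1)"
    by (simp add: F_def k_def add.commute)
  have "G = (2 * real n + 2) * (2 * real n + 1) * fact (2 * n)"
    by (simp add: G_def k_def algebra_simps)
  hence f2: "fact (2 * n) = G / ((2 * real n + 2) * (2 * real n + 1))"
    by (simp add: nonzero_eq_divide_eq)
  have "pochhammer (1/2 :: real) (2 * k) = pochhammer (1/2) (2 * n + 1) * (3/2 + 2 * real n)"
    by (simp add: k_def pochhammer_Suc add_ac)
  moreover have "pochhammer (1/2 :: real) (2 * k) = J / (16 ^ k * G)"
    unfolding pochhammer_one_half_eq J_def G_def by (simp add: power_mult)
  ultimately have eq: "pochhammer (1/2 :: real) (2 * n + 1) * (3/2 + 2 * real n) = J / (16 ^ k * G)"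
    by simp
  have "3/2 + 2 * real n \<noteq> 0" using of_nat_0_le_iff[of n, where 'a = real] by linarith
  hence "pochhammer (1/2 :: real) (2 * n + 1) =
      pochhammer (1/2) (2 * n + 1) * (3/2 + 2 * real n) / (3/2 + 2 * real n)"
    by simp
  also have "\<dots> = J / (16 ^ k * G * (3/2 + 2 * real n))"
    unfolding eq by simp
  finally have p: "pochhammer (1/2 :: real) (2 * n + 1) = J / (16 ^ k * G * (3/2 + 2 * real n))" .
  have pw: "(16 ^ k :: real) ^ 2 = 256 ^ k"
    by (simp add: power2_eq_square flip: power_mult_distrib)
  have sg: "(-256 :: real) ^ k = - ((-1) ^ n) * 256 ^ k"
    by (simp add: k_def) (metis mult_minus1 power_mult_distrib)
  define W :: real where "W = 16 ^ k"
  have W: "W > 0" by (simp add: W_def)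
  have lhs: "central_coeff n = (-1) ^ n * (F / (real n + 1)) ^ 2 * (G / ((2 * real n + 2) * (2 * real n + 1))) /
      ((1/2 + real n) * (J / (W * G * (3/2 + 2 * real n))) ^ 2)"
    unfolding central_coeff_def f1 f2 p W_def ..
  have rhs: "common_factor (n + 1) = - ((-1) ^ n) * W ^ 2 /
      ((real n + 1) ^ 3 * (2 * real n + 1) * (G / F ^ 2) * (J / G ^ 2) ^ 2)"
    unfolding common_factor_def k_def[symmetric] sg c1 c2 W_def pw by (simp add: k_def add_ac)
  define N where "N = real n"
  have N: "N + 1 > 0" "2 * N + 1 > 0" "4 * N + 3 > 0" by (simp_all add: N_def)
  have e: "2 * N + 2 = 2 * (N + 1)" "1/2 + N = (2 * N + 1) / 2" "3/2 + 2 * N = (4 * N + 3) / 2" by simp_all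
  define a b d where "a = N + 1" and "b = 2 * N + 1" and "d = 4 * N + 3"
  show ?thesis
    unfolding lhs rhs N_def[symmetric] e unfolding a_def[symmetric] b_def[symmetric] d_def[symmetric]
    using pos W N unfolding a_def[symmetric] b_def[symmetric] d_def[symmetric]
    by (simp add: field_simps power2_eq_square power3_eq_cube)
qed

lemma central_head_eq:
  "central_head n = (2 * real n + 1) * (40 * (real n + 1) ^ 2 - 24 * (real n + 1) + 3) / (2 * (4 * real n + 3) ^ 2)"
proof -
  have "central_head n = 3/2 + 3 * real n - (1 + real n) ^ 2 * (1 + 2 * real n) / ((4 * real n + 3) / 2) ^ 2"
    by (simp add: central_head_def add_divide_distrib)
  thus ?thesis
    by (simp add: power_divide divide_simps) (simp add: power2_eq_square algebra_simps)
qed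


lemma harmonic_odd_indices:
  "harmonic m (4 * n + 3) = harmonic m (4 * n + 2) + 1 / (4 * real n + 3) ^ m"
  "harmonic m (2 * n + 1) = harmonic m (2 * n) + 1 / (2 * real n + 1) ^ m"
proof -
  have "4 * n + 3 = Suc (4 * n + 2)" "real (4 * n + 2) + 1 = 4 * real n + 3" by simp_all
  thus "harmonic m (4 * n + 3) = harmonic m (4 * n + 2) + 1 / (4 * real n + 3) ^ m"
    by (simp only: harmonic_Suc)
  have "2 * n + 1 = Suc (2 * n)" "real (2 * n) + 1 = 2 * real n + 1" by simp_all
  thus "harmonic m (2 * n + 1) = harmonic m (2 * n) + 1 / (2 * real n + 1) ^ m"
    by (simp only: harmonic_Suc)
qed

lemma half_harmonic_values:
  "half_harmonic 1 n = 2 * harmonic1 (2 * n) - harmonic1 n"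
  "half_harmonic 1 (n + 1) = 2 * harmonic1 (2 * n) - harmonic1 n + 2 / (2 * real n + 1)"
  "half_harmonic 1 (2 * n + 1) = 2 * harmonic1 (4 * n + 3) - harmonic1 (2 * n + 1) - 2 / (4 * real n + 3)"
  "half_harmonic 2 (2 * n + 1) = 4 * harmonic 2 (4 * n + 3) - harmonic 2 (2 * n + 1) - 4 / (4 * real n + 3) ^ 2"
proof -
  show 1: "half_harmonic 1 n = 2 * harmonic1 (2 * n) - harmonic1 n"
    by (simp add: half_harmonic_eq)
  have "half_harmonic 1 (n + 1) = half_harmonic 1 n + 1 / (1/2 + real n)"
    by (simp add: half_harmonic_def)
  also have "1 / (1/2 + real n) = 2 / (2 * real n + 1)"
    by (simp add: field_simps)
  finally show "half_harmonic 1 (n + 1) = 2 * harmonic1 (2 * n) - harmonic1 n + 2 / (2 * real n + 1)"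
    unfolding 1 .
  have "2 * (2 * n + 1) = 4 * n + 2" by simp
  thus "half_harmonic 1 (2 * n + 1) = 2 * harmonic1 (4 * n + 3) - harmonic1 (2 * n + 1) - 2 / (4 * real n + 3)"
    "half_harmonic 2 (2 * n + 1) = 4 * harmonic 2 (4 * n + 3) - harmonic 2 (2 * n + 1) - 4 / (4 * real n + 3) ^ 2"
    unfolding half_harmonic_eq harmonic_odd_indices(1) by simp_all
qed

text \<open>
  The next three lemmas compare a term of a variation with a term of the theorem, where
  \<open>N = n = k - 1\<close>, \<open>U\<close> stands for \<open>common_factor k\<close>, and \<open>X\<close>, \<open>Y\<close>, \<open>Z\<close> for the
  combinations of harmonic numbers.
\<close>
lemma first_order_term_eq_1:
  fixes N X U :: real
  assumes "N \<ge> 0"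
  shows "- U * (4 * N + 3) ^ 2 / (4 * (2 * N + 1)) *
      ((- (2 / (2 * N + 1)) - 2 * (X - 2 / (4 * N + 3))) *
        ((2 * N + 1) * (40 * (N + 1) ^ 2 - 24 * (N + 1) + 3) / (2 * (4 * N + 3) ^ 2))
       + (1 - (1 + N) ^ 2 * (1 + 2 * N) / ((4 * N + 3) / 2) ^ 2 * (- 2 / ((4 * N + 3) / 2)))) =
    1/4 * (U * ((40 * (N + 1) ^ 2 - 24 * (N + 1) + 3) * X - 12 * (N + 1) + 4))"
proof -
  define b d where "b = 2 * N + 1" and "d = 4 * N + 3"
  have pos: "b \<noteq> 0" "d \<noteq> 0" using assms by (simp_all add: b_def d_def)
  have N: "1 + 2 * N = b" "N + 1 = (b + 1) / 2" "1 + N = (b + 1) / 2" "d = 2 * b + 1" by (simp_all add: b_def d_def)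
  show ?thesis
    unfolding b_def[symmetric] d_def[symmetric] N(1-3)
    using pos by (simp add: field_simps power2_eq_square) (simp add: N(4) algebra_simps)
qed

lemma first_order_term_eq_2:
  fixes N Y U :: real
  assumes "N \<ge> 0"
  shows "- U * (4 * N + 3) ^ 2 / (4 * (2 * N + 1)) *
      ((2 * Y - 4 / (2 * N + 1)) *
        ((2 * N + 1) * (40 * (N + 1) ^ 2 - 24 * (N + 1) + 3) / (2 * (4 * N + 3) ^ 2))
       + (- 1 - (1 + N) ^ 2 * (1 + 2 * N) / ((4 * N + 3) / 2) ^ 2 * (- 2 / (1 + N) - - 2 / (1 + 2 * N)))) =
    - 1/4 * (U * ((40 * (N + 1) ^ 2 - 24 * (N + 1) + 3) * Y
       - (88 * (N + 1) ^ 2 - 48 * (N + 1) + 7) / (2 * (N + 1) - 1)))"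
proof -
  define b d where "b = 2 * N + 1" and "d = 4 * N + 3"
  have pos: "b \<noteq> 0" "d \<noteq> 0" "b + 1 \<noteq> 0" using assms by (simp_all add: b_def d_def)
  have N: "1 + 2 * N = b" "2 * (N + 1) - 1 = b" "N + 1 = (b + 1) / 2" "1 + N = (b + 1) / 2" "d = 2 * b + 1"
    by (simp_all add: b_def d_def)
  have inner: "K ^ 2 * b / (d / 2) ^ 2 * (- 2 / K - - 2 / b) = (8 * K ^ 2 - 8 * K * b) / d ^ 2"
    if "K \<noteq> 0" for K
    using that pos by (simp add: field_simps power2_eq_square)
  have K: "1 + N \<noteq> 0" using assms by simp
  show ?thesis
    unfolding b_def[symmetric] d_def[symmetric] N(1,2) inner[OF K] unfolding N(3,4)
    using pos by (simp add: field_simps power2_eq_square) (simp add: N(5) algebra_simps)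
qed

lemma second_order_term_eq:
  fixes N Z U :: real
  assumes "N \<ge> 0"
  shows "- U * (4 * N + 3) ^ 2 / (4 * (2 * N + 1)) *
      ((Z - 4 / (4 * N + 3) ^ 2) *
        ((2 * N + 1) * (40 * (N + 1) ^ 2 - 24 * (N + 1) + 3) / (2 * (4 * N + 3) ^ 2))
       + (1 + 2 * N) * (1 / ((4 * N + 3) / 2) ^ 2 - (1 + N) ^ 2 / ((4 * N + 3) / 2) ^ 4)) =
    - 1/8 * (U * ((40 * (N + 1) ^ 2 - 24 * (N + 1) + 3) * Z - 4))"
proof -
  define b d where "b = 2 * N + 1" and "d = 4 * N + 3"
  have pos: "b \<noteq> 0" "d \<noteq> 0" using assms by (simp_all add: b_def d_def)
  have N: "1 + 2 * N = b" "N + 1 = (b + 1) / 2" "1 + N = (b + 1) / 2" "d = 2 * b + 1" by (simp_all add: b_def d_def)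
  show ?thesis
    unfolding b_def[symmetric] d_def[symmetric] N(1-3)
    using pos by (simp add: field_simps power2_eq_square power4_eq_xxxx) (simp add: N(4) algebra_simps)
qed

lemma three_halves: "3/2 + 2 * real n = (4 * real n + 3) / 2"
  by simp

lemma first_identity:
  "(\<lambda>n. common_factor (n + 1) * ((40 * real (n + 1) ^ 2 - 24 * real (n + 1) + 3) *
      (2 * harmonic1 (4 * n + 3) - harmonic1 (2 * n + 1)) - 12 * real (n + 1) + 4)) sums (- 4 * pi ^ 3)"
proof -
  define X where "X n = 2 * harmonic1 (4 * n + 3) - harmonic1 (2 * n + 1)" for n
  have L: "0 * harmonic1 n - 0 * harmonic1 (2 * n) + 1 * half_harmonic 1 n - 1 * half_harmonic 1 (n + 1)
      - (1 + 1) * half_harmonic 1 (2 * n + 1) = - (2 / (2 * real n + 1)) - 2 * (X n - 2 / (4 * real n + 3))" for n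
    unfolding half_harmonic_values(2,3)[of n] unfolding half_harmonic_values(1) X_def by simp
  have "(\<lambda>n. 1/4 * (common_factor (n + 1) * ((40 * (real n + 1) ^ 2 - 24 * (real n + 1) + 3) * X n
      - 12 * (real n + 1) + 4))) sums (- 1 * pi ^ 3)"
  proof -
    have c: "(1 - 1) / 2 = (0::real)" "(1 + 1) / 2 = (1::real)" "0 / x - 0 / y - (1 + 1) / z = - 2 / z" for x y z :: real by simp_all
    show ?thesis
      using first_order_variation[of 1 1, unfolded c(1,2) L central_coeff_eq central_head_eq three_halves c(3)
          first_order_term_eq_1[OF of_nat_0_le_iff]]
      by simp
  qed
  from sums_mult[OF this, of 4] show ?thesis
    by (simp add: X_def add.commute)
qed

lemma second_identity:
  "(\<lambda>n. common_factor (n + 1) * ((40 * real (n + 1) ^ 2 - 24 * real (n + 1) + 3) *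
      (5 * harmonic1 (2 * n + 1) - 3 * harmonic1 n)
      - (88 * real (n + 1) ^ 2 - 48 * real (n + 1) + 7) / (2 * real (n + 1) - 1))) sums (- 4 * pi ^ 3)"
proof -
  define Y where "Y n = 5 * harmonic1 (2 * n + 1) - 3 * harmonic1 n" for n
  have L: "(-2) * harmonic1 n - (-2) * harmonic1 (2 * n) + 1 * half_harmonic 1 n - (-3) * half_harmonic 1 (n + 1)
      - (1 + (-1)) * half_harmonic 1 (2 * n + 1) = 2 * Y n - 4 / (2 * real n + 1)" for n
    unfolding half_harmonic_values(2,3)[of n] unfolding half_harmonic_values(1) Y_def harmonic_odd_indices(2) by simp
  have "(\<lambda>n. - 1/4 * (common_factor (n + 1) * ((40 * (real n + 1) ^ 2 - 24 * (real n + 1) + 3) * Y n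
      - (88 * (real n + 1) ^ 2 - 48 * (real n + 1) + 7) / (2 * (real n + 1) - 1)))) sums (pi ^ 3)"
  proof -
    have c: "(- 3 - 1) / 2 = (- 2::real)" "(1 + - 3) / 2 = (- 1::real)" "x - (1 + - 1) / z = (x :: real)" for x z by simp_all
    show ?thesis
      using first_order_variation[of 1 "-3", unfolded c(1,2) L central_coeff_eq central_head_eq three_halves c(3)
          first_order_term_eq_2[OF of_nat_0_le_iff]]
      by simp
  qed
  from sums_mult[OF this, of "- 4"] show ?thesis
    by (simp add: Y_def add.commute)
qed

lemma third_identity:
  "(\<lambda>n. common_factor (n + 1) * ((40 * real (n + 1) ^ 2 - 24 * real (n + 1) + 3) *
      (4 * harmonic 2 (4 * n + 3) - harmonic 2 (2 * n + 1) - harmonic 2 n) - 4)) sums (- 256 * dirichlet_beta 4)"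
proof -
  define Z where "Z n = 4 * harmonic 2 (4 * n + 3) - harmonic 2 (2 * n + 1) - harmonic 2 n" for n
  have L: "half_harmonic 2 (2 * n + 1) - harmonic 2 n = Z n - 4 / (4 * real n + 3) ^ 2" for n
    unfolding half_harmonic_values Z_def by simp
  have "(\<lambda>n. - 1/8 * (common_factor (n + 1) * ((40 * (real n + 1) ^ 2 - 24 * (real n + 1) + 3) * Z n - 4)))
      sums (32 * dirichlet_beta 4)"
    using second_order_variation[unfolded L central_coeff_eq central_head_eq three_halves
        second_order_term_eq[OF of_nat_0_le_iff]] .
  from sums_mult[OF this, of "- 8"] show ?thesis
    by (simp add: Z_def add.commute)
qed

theorem theorem1p20:
  shows "((\<lambda>n::nat. let k = n + 1 in
           (-256) ^ k *
             ((40 * real k ^ 2 - 24 * real k + 3) * (2 * harmonic1 (4 * k - 1) - harmonic1 (2 * k - 1))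
               - 12 * real k + 4)
           / (real k ^ 3 * (2 * real k - 1) * real ((2 * k) choose k) * real ((4 * k) choose (2 * k)) ^ 2))
         sums (- 4 * pi ^ 3))
       \<and> ((\<lambda>n::nat. let k = n + 1 in
           (-256) ^ k *
             ((40 * real k ^ 2 - 24 * real k + 3) * (5 * harmonic1 (2 * k - 1) - 3 * harmonic1 (k - 1))
               - (88 * real k ^ 2 - 48 * real k + 7) / (2 * real k - 1))
           / (real k ^ 3 * (2 * real k - 1) * real ((2 * k) choose k) * real ((4 * k) choose (2 * k)) ^ 2))
         sums (- 4 * pi ^ 3))
       \<and> ((\<lambda>n::nat. let k = n + 1 in
           (-256) ^ k *
             ((40 * real k ^ 2 - 24 * real k + 3)
                * (4 * harmonic 2 (4 * k - 1) - harmonic 2 (2 * k - 1) - harmonic 2 (k - 1))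
               - 4)
           / (real k ^ 3 * (2 * real k - 1) * real ((2 * k) choose k) * real ((4 * k) choose (2 * k)) ^ 2))
         sums (- 256 * dirichlet_beta 4))"
proof -
  have idx: "4 * (n + 1) - 1 = 4 * n + 3" "2 * (n + 1) - 1 = 2 * n + 1" "n + 1 - 1 = n" for n :: nat
    by simp_all
  have factor: "(-256) ^ k * x / (real k ^ 3 * (2 * real k - 1) * real ((2 * k) choose k) *
      real ((4 * k) choose (2 * k)) ^ 2) = common_factor k * x" for k x
    by (simp add: common_factor_def)
  show ?thesis
    unfolding Let_def idx factor
    using first_identity second_identity third_identity by blast
qed

end
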